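(* Let $k$ be an algebraically closed field of characteristic two. Consider a (possibly singular) cubic surface $\mathcal X\subset\mathbb P^3$ over $k$ that is not Frobenius split. If two lines $\ell_1$ and $\ell_2$ on $\mathcal X$ meet at a point, then either one of the lines is a double line, or the intersection is an Eckardt point. That is, a non-Frobenius split cubic surface of characteristic two contains no triangles.
   Context: A cubic surface is the subscheme of $\mathbb P^3$ cut out by a single homogeneous polynomial of degree 3; it may be singular, reducible, non-reduced, or a cone. A scheme $X$ over a field of characteristic $p>0$ is Frobenius split if the map of sheaves $\mathcal O_X\to F_*\mathcal O_X$ induced by the Frobenius morphism $F:X\to X$ (the identity on the underlying space, the $p$-th power map on functions) splits. A point on a cubic surface is an Eckardt point if it is an intersection point of three distinct lines on the surface. A triangle is a set of three coplanar lines on the surface that do not meet at a point. One of the lines $\ell_1,\ell_2$ being a double line refers to the case where, in the plane section of $\mathcal X$ by the plane spanned by $\ell_1$ and $\ell_2$, the third line coincides with $\ell_1$ or $\ell_2$.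
   Formalization: "Contains no triangles" is proved only for triangles whose plane is not contained in the surface; as stated it fails for surfaces containing a plane, e.g. x²y=0, which is not Frobenius split and contains every triangle in the plane y=0. *)

theory Defs
  imports
    "HOL-Analysis.Analysis"
    "HOL-Library.Poly_Mapping"
    "HOL-Algebra.Ideal"
begin

section \<open>Frobenius splitting of a sheaf of rings\<close>

text \<open>
  A sheaf of rings on a topological space \<open>X\<close> is given by its rings of sections \<open>\<O> U\<close> and its
  restriction maps \<open>res U V\<close> for \<open>V \<subseteq> U\<close>.  The abelian group of sections of \<open>F\<^sub>*\<O>\<close> over \<open>U\<close> is that
  of \<open>\<O> U\<close>, on which \<open>a\<close> acts as multiplication by \<open>a ^ p\<close>.  The family \<open>\<phi>\<close> below is thus an
  \<open>\<O>\<close>-linear map of sheaves \<open>F\<^sub>*\<O> \<rightarrow> \<O>\<close>, and it is a left inverse of \<open>a \<mapsto> a ^ p\<close>.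
\<close>

definition frobenius_split ::
  "nat \<Rightarrow> 'x topology \<Rightarrow> ('x set \<Rightarrow> 's ring) \<Rightarrow> ('x set \<Rightarrow> 'x set \<Rightarrow> 's \<Rightarrow> 's) \<Rightarrow> bool" where
  "frobenius_split p X \<O> res \<longleftrightarrow>
    (\<exists>\<phi>. (\<forall>U. openin X U \<longrightarrow>
            \<phi> U \<in> carrier (\<O> U) \<rightarrow> carrier (\<O> U) \<and>
            (\<forall>a\<in>carrier (\<O> U). \<forall>b\<in>carrier (\<O> U).
               \<phi> U (a \<oplus>\<^bsub>\<O> U\<^esub> b) = \<phi> U a \<oplus>\<^bsub>\<O> U\<^esub> \<phi> U b) \<and>
            (\<forall>a\<in>carrier (\<O> U). \<forall>b\<in>carrier (\<O> U).
               \<phi> U ((a [^]\<^bsub>\<O> U\<^esub> p) \<otimes>\<^bsub>\<O> U\<^esub> b) = a \<otimes>\<^bsub>\<O> U\<^esub> \<phi> U b) \<and>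
            (\<forall>a\<in>carrier (\<O> U). \<phi> U (a [^]\<^bsub>\<O> U\<^esub> p) = a)) \<and>
         (\<forall>U V. openin X U \<longrightarrow> openin X V \<longrightarrow> V \<subseteq> U \<longrightarrow>
            (\<forall>a\<in>carrier (\<O> U). \<phi> V (res U V a) = res U V (\<phi> U a))))"

section \<open>Forms in four variables\<close>

type_synonym 'k poly4 = "(4 \<Rightarrow>\<^sub>0 nat) \<Rightarrow>\<^sub>0 'k"

definition homogeneous :: "nat \<Rightarrow> 'k::zero poly4 \<Rightarrow> bool" where
  "homogeneous d p \<longleftrightarrow> (\<forall>m\<in>Poly_Mapping.keys p. (\<Sum>i\<in>UNIV. Poly_Mapping.lookup m i) = d)"

definition var :: "4 \<Rightarrow> 'k::comm_ring_1 poly4" where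
  "var i = Poly_Mapping.single (Poly_Mapping.single i 1) 1"

definition poly_eval :: "'k::comm_ring_1 poly4 \<Rightarrow> 'k ^ 4 \<Rightarrow> 'k" where
  "poly_eval p v =
    (\<Sum>m\<in>Poly_Mapping.keys p. Poly_Mapping.lookup p m * (\<Prod>i\<in>UNIV. (v $ i) ^ Poly_Mapping.lookup m i))"

definition poly_ring :: "'k::comm_ring_1 poly4 ring" where
  "poly_ring = \<lparr>carrier = UNIV, mult = (*), one = 1, zero = 0, add = (+)\<rparr>"

section \<open>The closed subscheme of projective space cut out by a form\<close>

text \<open>
  The scheme \<open>Proj (S/(f))\<close>, where \<open>S\<close> is the polynomial ring in four variables.  The homogeneous
  primes of \<open>S/(f)\<close> are represented by the homogeneous primes of \<open>S\<close> that contain \<open>f\<close>, and the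
  elements of \<open>S/(f)\<close> by polynomials, compared modulo \<open>f\<close>.
\<close>

definition homogeneous_ideal :: "'k::comm_ring_1 poly4 set \<Rightarrow> bool" where
  "homogeneous_ideal I \<longleftrightarrow> ideal I poly_ring \<and> I = Idl\<^bsub>poly_ring\<^esub> {p \<in> I. \<exists>d. homogeneous d p}"

definition Proj_points :: "'k::comm_ring_1 poly4 \<Rightarrow> 'k poly4 set set" where
  "Proj_points f =
    {P. primeideal P poly_ring \<and> homogeneous_ideal P \<and> f \<in> P \<and> (\<exists>i. var i \<notin> P)}"

definition Proj_top :: "'k::comm_ring_1 poly4 \<Rightarrow> 'k poly4 set topology" where
  "Proj_top f =
    topology (\<lambda>U. \<exists>A. (\<forall>p\<in>A. \<exists>d. homogeneous d p) \<and> U = {P \<in> Proj_points f. \<not> A \<subseteq> P})"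

lemma homogeneous_mult:
  fixes p q :: "'k::comm_ring_1 poly4"
  assumes "homogeneous d p" "homogeneous e q"
  shows "homogeneous (d + e) (p * q)"
  unfolding homogeneous_def
proof
  fix m
  assume "m \<in> Poly_Mapping.keys (p * q)"
  then obtain a b where "m = a + b" "a \<in> Poly_Mapping.keys p" "b \<in> Poly_Mapping.keys q"
    using keys_mult[of p q] by auto
  then show "(\<Sum>i\<in>UNIV. Poly_Mapping.lookup m i) = d + e"
    using assms by (simp add: homogeneous_def lookup_add sum.distrib)
qed

lemma istopology_Proj:
  fixes f :: "'k::comm_ring_1 poly4"
  shows "istopology
    (\<lambda>U. \<exists>A. (\<forall>p\<in>A. \<exists>d. homogeneous d p) \<and> U = {P \<in> Proj_points f. \<not> A \<subseteq> P})"
  unfolding istopology_def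
proof (intro conjI allI impI)
  fix U V
  assume "\<exists>A. (\<forall>p\<in>A. \<exists>d. homogeneous d p) \<and> U = {P \<in> Proj_points f. \<not> A \<subseteq> P}"
    and "\<exists>A. (\<forall>p\<in>A. \<exists>d. homogeneous d p) \<and> V = {P \<in> Proj_points f. \<not> A \<subseteq> P}"
  then obtain A B where A: "\<forall>p\<in>A. \<exists>d. homogeneous d p" "U = {P \<in> Proj_points f. \<not> A \<subseteq> P}"
    and B: "\<forall>p\<in>B. \<exists>d. homogeneous d p" "V = {P \<in> Proj_points f. \<not> B \<subseteq> P}"
    by auto
  define C where "C = {a * b |a b. a \<in> A \<and> b \<in> B}"
  have "C \<subseteq> P \<longleftrightarrow> A \<subseteq> P \<or> B \<subseteq> P" if "P \<in> Proj_points f" for P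
  proof -
    interpret primeideal P poly_ring
      using that by (simp add: Proj_points_def)
    have prime: "a \<in> P \<or> b \<in> P" if "a * b \<in> P" for a b
      using I_prime[of a b] that by (simp add: poly_ring_def)
    have mult: "a * b \<in> P" if "a \<in> P \<or> b \<in> P" for a b
      using I_l_closed[of b a] I_r_closed[of a b] that by (auto simp: poly_ring_def)
    show ?thesis
      unfolding C_def using prime mult by blast
  qed
  moreover have "\<forall>p\<in>C. \<exists>d. homogeneous d p"
    unfolding C_def using A(1) B(1) homogeneous_mult by blast
  ultimately show "\<exists>A. (\<forall>p\<in>A. \<exists>d. homogeneous d p) \<and> U \<inter> V = {P \<in> Proj_points f. \<not> A \<subseteq> P}"
    unfolding A(2) B(2) by (intro exI[of _ C]) auto
next
  fix K
  assume "\<forall>U\<in>K. \<exists>A. (\<forall>p\<in>A. \<exists>d. homogeneous d p) \<and> U = {P \<in> Proj_points f. \<not> A \<subseteq> P}"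
  from bchoice[OF this] obtain A where A:
    "\<forall>U\<in>K. (\<forall>p\<in>A U. \<exists>d. homogeneous d p) \<and> U = {P \<in> Proj_points f. \<not> A U \<subseteq> P}"
    by (rule exE)
  have hom: "\<forall>p\<in>A U. \<exists>d. homogeneous d p" and K: "U = {P \<in> Proj_points f. \<not> A U \<subseteq> P}"
    if "U \<in> K" for U
    using bspec[OF A that] by (rule conjunct1, rule conjunct2)
  have "P \<in> \<Union>K \<longleftrightarrow> P \<in> Proj_points f \<and> \<not> (\<Union>U\<in>K. A U) \<subseteq> P" for P
  proof -
    have "P \<in> U \<longleftrightarrow> P \<in> Proj_points f \<and> \<not> A U \<subseteq> P" if "U \<in> K" for U
      by (subst K[OF that]) simp
    then show ?thesis
      by (simp add: UN_subset_iff Bex_def)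
  qed
  then have "\<Union>K = {P \<in> Proj_points f. \<not> (\<Union>U\<in>K. A U) \<subseteq> P}"
    by (simp add: set_eq_iff)
  moreover have "\<forall>p\<in>(\<Union>U\<in>K. A U). \<exists>d. homogeneous d p"
    using hom by (simp add: Ball_def) blast
  ultimately show "\<exists>A. (\<forall>p\<in>A. \<exists>d. homogeneous d p) \<and> \<Union>K = {P \<in> Proj_points f. \<not> A \<subseteq> P}"
    by (intro exI[of _ "\<Union>U\<in>K. A U"] conjI)
qed

lemma openin_Proj_top:
  "openin (Proj_top f) U \<longleftrightarrow>
    (\<exists>A. (\<forall>p\<in>A. \<exists>d. homogeneous d p) \<and> U = {P \<in> Proj_points f. \<not> A \<subseteq> P})"
  unfolding Proj_top_def topology_inverse'[OF istopology_Proj] ..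

text \<open>
  \<open>germ f P a b\<close> is the element \<open>a/b\<close> of the degree zero part of the homogeneous localization of
  \<open>S/(f)\<close> at \<open>P\<close>: the class of all pairs of numerator and denominator that represent it.
\<close>

type_synonym 'k germ = "('k poly4 \<times> 'k poly4) set"

definition germ :: "'k::comm_ring_1 poly4 \<Rightarrow> 'k poly4 set \<Rightarrow> 'k poly4 \<Rightarrow> 'k poly4 \<Rightarrow> 'k germ" where
  "germ f P a b =
    {(a', b'). (\<exists>d. homogeneous d a' \<and> homogeneous d b') \<and> b' \<notin> P \<and>
       (\<exists>t e. homogeneous e t \<and> t \<notin> P \<and> f dvd t * (a * b' - a' * b))}"

text \<open>
  As usual for operations on equivalence classes, the unions run over all representatives, each of
  which yields the same class.
\<close>

definition germ_add :: "'k::comm_ring_1 poly4 \<Rightarrow> 'k poly4 set \<Rightarrow> 'k germ \<Rightarrow> 'k germ \<Rightarrow> 'k germ" where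
  "germ_add f P x y = (\<Union>(a, b)\<in>x. \<Union>(c, d)\<in>y. germ f P (a * d + c * b) (b * d))"

definition germ_mult :: "'k::comm_ring_1 poly4 \<Rightarrow> 'k poly4 set \<Rightarrow> 'k germ \<Rightarrow> 'k germ \<Rightarrow> 'k germ" where
  "germ_mult f P x y = (\<Union>(a, b)\<in>x. \<Union>(c, d)\<in>y. germ f P (a * c) (b * d))"

definition sections :: "'k::comm_ring_1 poly4 \<Rightarrow> 'k poly4 set set \<Rightarrow> ('k poly4 set \<Rightarrow> 'k germ) set" where
  "sections f U =
    {s \<in> extensional U. \<forall>P\<in>U. \<exists>V a b d. openin (Proj_top f) V \<and> P \<in> V \<and> V \<subseteq> U \<and>
       homogeneous d a \<and> homogeneous d b \<and> (\<forall>Q\<in>V. b \<notin> Q \<and> s Q = germ f Q a b)}"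

definition structure_sheaf ::
  "'k::comm_ring_1 poly4 \<Rightarrow> 'k poly4 set set \<Rightarrow> ('k poly4 set \<Rightarrow> 'k germ) ring" where
  "structure_sheaf f U =
    \<lparr>carrier = sections f U,
     mult = (\<lambda>s t. \<lambda>P\<in>U. germ_mult f P (s P) (t P)),
     one = (\<lambda>P\<in>U. germ f P 1 1),
     zero = (\<lambda>P\<in>U. germ f P 0 1),
     add = (\<lambda>s t. \<lambda>P\<in>U. germ_add f P (s P) (t P))\<rparr>"

definition surface_frobenius_split :: "'k::comm_ring_1 poly4 \<Rightarrow> bool" where
  "surface_frobenius_split f \<longleftrightarrow>
    frobenius_split CHAR('k) (Proj_top f) (structure_sheaf f) (\<lambda>U V s. restrict s V)"

section \<open>Lines, Eckardt points and triangles on a surface\<close>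

text \<open>
  Points, lines and planes of projective space are the linear subspaces of \<open>k\<^sup>4\<close> of vector space
  dimension 1, 2 and 3.
\<close>

definition proj_flat :: "nat \<Rightarrow> ('k::field ^ 4) set \<Rightarrow> bool" where
  "proj_flat d V \<longleftrightarrow> vec.subspace V \<and> vec.dim V = d + 1"

definition zeros :: "'k::comm_ring_1 poly4 \<Rightarrow> ('k ^ 4) set" where
  "zeros p = {v. poly_eval p v = 0}"

text \<open>
  Over an infinite field, a line is a subscheme of the surface if and only if the equation of the
  surface vanishes at the points of the line.
\<close>

definition line_on :: "'k::field poly4 \<Rightarrow> ('k ^ 4) set \<Rightarrow> bool" where
  "line_on f L \<longleftrightarrow> proj_flat 1 L \<and> L \<subseteq> zeros f"

definition eckardt_point :: "'k::field poly4 \<Rightarrow> ('k ^ 4) set \<Rightarrow> bool" where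
  "eckardt_point f P \<longleftrightarrow> proj_flat 0 P \<and>
    (\<exists>L M N. line_on f L \<and> line_on f M \<and> line_on f N \<and> L \<noteq> M \<and> L \<noteq> N \<and> M \<noteq> N \<and> L \<inter> M \<inter> N = P)"

text \<open>
  The section of the surface by the plane \<open>H\<close> is, as a scheme (that is, with multiplicities), the
  sum of the lines \<open>L\<close>, \<open>M\<close>, \<open>N\<close>: modulo the equation \<open>h\<close> of \<open>H\<close>, the form \<open>f\<close> is the product of
  linear forms that cut out these lines in \<open>H\<close>.
\<close>

definition plane_section ::
  "'k::field poly4 \<Rightarrow> ('k ^ 4) set \<Rightarrow> ('k ^ 4) set \<Rightarrow> ('k ^ 4) set \<Rightarrow> ('k ^ 4) set \<Rightarrow> bool" where
  "plane_section f H L M N \<longleftrightarrow>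
    proj_flat 2 H \<and> proj_flat 1 L \<and> proj_flat 1 M \<and> proj_flat 1 N \<and>
    (\<exists>h l m n. homogeneous 1 h \<and> homogeneous 1 l \<and> homogeneous 1 m \<and> homogeneous 1 n \<and>
       H = zeros h \<and> L = H \<inter> zeros l \<and> M = H \<inter> zeros m \<and> N = H \<inter> zeros n \<and>
       h dvd f - l * m * n)"

text \<open>
  For distinct meeting lines \<open>L\<close> and \<open>M\<close>, the span of their union is the plane that contains both,
  and \<open>N\<close> is the third line of the section by that plane.
\<close>

definition one_is_double :: "'k::field poly4 \<Rightarrow> ('k ^ 4) set \<Rightarrow> ('k ^ 4) set \<Rightarrow> bool" where
  "one_is_double f L M \<longleftrightarrow>
    (\<exists>N. plane_section f (vec.span (L \<union> M)) L M N \<and> (N = L \<or> N = M))"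

text \<open>
  When the surface contains the plane \<open>H\<close>, every set of three lines of \<open>H\<close> without common point is
  a triangle in this sense.  For example, \<open>x\<^sup>2 y\<close> defines a surface that is not reduced, hence not
  Frobenius split, and contains such triangles.  Statements about triangles that are meant for plane
  sections thus have to restrict \<open>H\<close> to the planes that the surface does not contain.
\<close>

definition triangle_in_plane :: "'k::field poly4 \<Rightarrow> ('k ^ 4) set \<Rightarrow> ('k ^ 4) set set \<Rightarrow> bool" where
  "triangle_in_plane f H T \<longleftrightarrow>
    proj_flat 2 H \<and> card T = 3 \<and> (\<forall>L\<in>T. line_on f L \<and> L \<subseteq> H) \<and> \<Inter>T = {0}"

end

theory Submission
  imports Defs
begin

text \<open>
  Write \<open>S\<close> for the polynomial ring in the coordinates \<open>x\<^sub>1, \<dots>, x\<^sub>4\<close>.  The proof turns the failure of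
  Frobenius splitting into a statement about monomials, and then reads off the plane sections.

  In characteristic two, \<open>S\<close> carries the Cartier operator, which is additive, sends \<open>a\<^sup>2 g\<close> to \<open>a\<close> times
  the image of \<open>g\<close>, and sees only the monomials with all exponents odd.  If the cubic form \<open>f\<close> contains
  a product of three distinct coordinates, then \<open>\<phi>(g) = cartier (f s g)\<close>, for a suitable linear form \<open>s\<close>,
  induces a splitting of the Frobenius of \<open>S/(f)\<close> (\<open>surface_frobenius_split_if_squarefree_monomial\<close>).  As it halves
  degrees, it acts on fractions of degree zero by \<open>a/b \<mapsto> \<phi>(ab)/b\<close>, which splits the structure sheaf of
  the projective surface (locale \<open>graded_frobenius_splitting\<close>).

  Hence if the surface is not Frobenius split, all monomials of \<open>f\<close> are of the form
  \<open>x\<^sub>i\<^sup>2 x\<^sub>j\<close>.  Since squaring is additive, this property of \<open>f\<close> survives every linear change of coordinates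
  (\<open>square_combination_linear_change\<close>).  Given two lines on the surface that meet in a point, take
  coordinates in which they are \<open>y\<^sub>3 = y\<^sub>4 = 0\<close> and \<open>y\<^sub>2 = y\<^sub>4 = 0\<close>.  On their plane \<open>y\<^sub>4 = 0\<close>, the form \<open>f\<close>
  is divisible by \<open>y\<^sub>2 y\<^sub>3\<close> and does not contain \<open>y\<^sub>1 y\<^sub>2 y\<^sub>3\<close>, so that it is
  \<open>y\<^sub>2 y\<^sub>3 (b y\<^sub>2 + c y\<^sub>3)\<close> (\<open>plane_section_of_meeting_lines\<close>).  The section thus consists of lines
  through the common point, unless \<open>f\<close> vanishes on the plane.  Both assertions follow: the third
  line is one of the two or makes the point an Eckardt point, and a line of the plane that avoids the
  point can be on the surface only if the whole plane is.  If the whole plane is, it supplies a third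
  line through the point.
\<close>

section \<open>Polynomials in four variables\<close>

abbreviation const :: "'k::comm_ring_1 \<Rightarrow> 'k poly4" where
  "const c \<equiv> Poly_Mapping.single 0 c"

lemma poly4_eq_sum_monomials:
  "p = (\<Sum>m\<in>Poly_Mapping.keys p. Poly_Mapping.single m (Poly_Mapping.lookup p m))"
proof (rule poly_mapping_eqI)
  fix k
  show "Poly_Mapping.lookup p k =
    Poly_Mapping.lookup (\<Sum>m\<in>Poly_Mapping.keys p. Poly_Mapping.single m (Poly_Mapping.lookup p m)) k"
    by (simp add: lookup_sum lookup_single when_def in_keys_iff)
qed

lemma poly4_induct [case_names single add]:
  assumes single: "\<And>m c. P (Poly_Mapping.single m c)"
    and add: "\<And>p q. P p \<Longrightarrow> P q \<Longrightarrow> P (p + q)"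
  shows "P (p :: 'k::comm_ring_1 poly4)"
proof -
  have zero: "P 0"
    using single[of 0 0] by simp
  have "P (\<Sum>m\<in>A. Poly_Mapping.single m (g m))" if "finite A" for A :: "(4 \<Rightarrow>\<^sub>0 nat) set" and g
    using that by induction (auto intro: zero single add)
  then show ?thesis
    by (subst poly4_eq_sum_monomials) simp
qed

lemma poly_eval_superset:
  assumes "finite A" "Poly_Mapping.keys p \<subseteq> A"
  shows "poly_eval p v =
    (\<Sum>m\<in>A. Poly_Mapping.lookup p m * (\<Prod>i\<in>UNIV. (v $ i) ^ Poly_Mapping.lookup m i))"
  unfolding poly_eval_def using assms
  by (intro sum.mono_neutral_left) (auto simp: in_keys_iff)

lemma poly_eval_add [simp]: "poly_eval (p + q) v = poly_eval p v + poly_eval q v"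
proof -
  let ?A = "Poly_Mapping.keys p \<union> Poly_Mapping.keys q"
  have "Poly_Mapping.keys (p + q) \<subseteq> ?A"
    by (rule keys_add)
  then show ?thesis
    by (simp add: poly_eval_superset[of ?A] lookup_add sum.distrib algebra_simps)
qed

lemma poly_eval_single:
  "poly_eval (Poly_Mapping.single m c) v = c * (\<Prod>i\<in>UNIV. (v $ i) ^ Poly_Mapping.lookup m i)"
  by (subst poly_eval_superset[of "{m}"]) auto

lemma poly_eval_const [simp]: "poly_eval (const c) v = c"
  by (simp add: poly_eval_single)

lemma poly_eval_var [simp]: "poly_eval (var i) v = v $ i"
proof -
  have "(\<Prod>j\<in>UNIV. (v $ j) ^ Poly_Mapping.lookup (Poly_Mapping.single i (1::nat)) j)
      = (\<Prod>j\<in>UNIV. if j = i then v $ j else 1)"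
    by (intro prod.cong) (auto simp: lookup_single when_def)
  then show ?thesis
    by (simp add: var_def poly_eval_single)
qed

lemma poly_eval_mult [simp]: "poly_eval (p * q) v = poly_eval p v * poly_eval q v"
proof (induction p rule: poly4_induct)
  case (single m c)
  show ?case
  proof (induction q rule: poly4_induct)
    case (single n d)
    show ?case
      by (simp add: mult_single poly_eval_single lookup_add power_add prod.distrib algebra_simps)
  qed (simp add: algebra_simps)
qed (simp add: algebra_simps)

lemma poly_eval_sum [simp]: "poly_eval (sum g A) v = (\<Sum>x\<in>A. poly_eval (g x) v)"
proof (induction A rule: infinite_finite_induct)
  case (insert x A)
  then show ?case by simp
qed (simp_all add: poly_eval_def)

lemma poly_eval_power [simp]: "poly_eval (p ^ n) v = poly_eval p v ^ n"
  by (induction n) (simp_all flip: single_one)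

lemma homogeneous_add: "homogeneous d p \<Longrightarrow> homogeneous d q \<Longrightarrow> homogeneous d (p + q)"
  using keys_add[of p q] by (auto simp: homogeneous_def)

lemma homogeneous_zero: "homogeneous d 0"
  by (simp add: homogeneous_def)

lemma homogeneous_sum: "(\<And>x. x \<in> A \<Longrightarrow> homogeneous d (g x)) \<Longrightarrow> homogeneous d (sum g A)"
  by (induction A rule: infinite_finite_induct) (auto simp: homogeneous_zero homogeneous_add)

lemma homogeneous_const: "homogeneous 0 (const c)"
  by (simp add: homogeneous_def)

lemma homogeneous_one: "homogeneous 0 (1 :: 'k::comm_ring_1 poly4)"
  using homogeneous_const[of "1::'k"] by simp

lemma homogeneous_var: "homogeneous 1 (var i :: 'k::comm_ring_1 poly4)"
  by (simp add: homogeneous_def var_def lookup_single when_def)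

lemma homogeneous_const_mult: "homogeneous d p \<Longrightarrow> homogeneous d (const c * p)"
  using homogeneous_mult[OF homogeneous_const] by fastforce

section \<open>Squares and square roots in characteristic two\<close>

lemma two_eq_0: "CHAR('a::comm_ring_1) = 2 \<Longrightarrow> (2 :: 'a) = 0"
  by (metis of_nat_CHAR of_nat_numeral)

lemma two_eq_0_poly4: "CHAR('k::comm_ring_1) = 2 \<Longrightarrow> (2 :: 'k poly4) = 0"
  using single_numeral[of "num.Bit0 num.One", where ?'a = "4 \<Rightarrow>\<^sub>0 nat" and ?'b = 'k]
    two_eq_0[where ?'a = 'k]
  by simp

lemma square_add:
  fixes a b :: "'a::comm_ring_1"
  assumes "(2::'a) = 0"
  shows "(a + b)\<^sup>2 = a\<^sup>2 + b\<^sup>2"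
proof -
  have "(a + b)\<^sup>2 = a\<^sup>2 + b\<^sup>2 + 2 * a * b"
    by (rule power2_sum)
  then show ?thesis
    by (simp only: assms mult_zero_left add_0_right)
qed

lemma square_sum:
  fixes g :: "'b \<Rightarrow> 'a::comm_ring_1"
  assumes "(2::'a) = 0"
  shows "(sum g A)\<^sup>2 = (\<Sum>x\<in>A. (g x)\<^sup>2)"
proof (induction A rule: infinite_finite_induct)
  case (insert x A)
  then show ?case
    by (simp only: sum.insert square_add[OF assms] not_False_eq_True)
qed simp_all

text \<open>
  In characteristic two square roots are unique, so the choice is additive and multiplicative.
\<close>

definition square_root :: "'k::alg_closed_field \<Rightarrow> 'k" where
  "square_root c = (SOME x. x\<^sup>2 = c)"

lemma square_root_power2: "(square_root c)\<^sup>2 = c"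
proof -
  have "\<exists>x. x\<^sup>2 = c"
    using nth_root_exists[of 2 c] by simp
  then show ?thesis
    unfolding square_root_def by (rule someI_ex)
qed

lemma square_inj:
  fixes x y :: "'k::field"
  assumes "CHAR('k) = 2" "x\<^sup>2 = y\<^sup>2"
  shows "x = y"
proof -
  have "(x - y)\<^sup>2 + 2 * (x - y) * y = 0"
    using assms(2) by (simp add: power2_eq_square algebra_simps)
  then have "(x - y)\<^sup>2 = 0"
    by (simp only: two_eq_0[OF assms(1)] mult_zero_left add_0_right)
  then show ?thesis
    by simp
qed

lemma square_root_add:
  fixes a b :: "'k::alg_closed_field"
  assumes "CHAR('k) = 2"
  shows "square_root (a + b) = square_root a + square_root b"
  by (rule square_inj[OF assms])
    (simp only: square_root_power2 square_add[OF two_eq_0[OF assms]])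

lemma square_root_mult:
  fixes a b :: "'k::alg_closed_field"
  assumes "CHAR('k) = 2"
  shows "square_root (a\<^sup>2 * b) = a * square_root b"
  by (rule square_inj[OF assms]) (simp add: square_root_power2 power_mult_distrib)

lemma square_root_0 [simp]: "square_root 0 = 0"
  using square_root_power2[of 0] by simp

lemma square_root_1 [simp]: "CHAR('k) = 2 \<Longrightarrow> square_root (1::'k::alg_closed_field) = 1"
  by (rule square_inj) (simp_all add: square_root_power2)

section \<open>The Cartier operator\<close>

definition ones :: "4 \<Rightarrow>\<^sub>0 nat" where
  "ones = (\<Sum>i\<in>UNIV. Poly_Mapping.single i 1)"

lemma lookup_ones [simp]: "Poly_Mapping.lookup ones i = 1"
  by (simp add: ones_def lookup_sum lookup_single when_def)

text \<open>
  As a module over its squares, the polynomial ring is free on the monomials in which every exponent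
  is 0 or 1.  This is the square root of the coordinate of \<open>g\<close> at the monomial in which every exponent
  is 1: the Cartier operator of affine space, with forms of top degree identified with polynomials.
\<close>

definition cartier :: "'k::alg_closed_field poly4 \<Rightarrow> 'k poly4" where
  "cartier g = Abs_poly_mapping (\<lambda>m. square_root (Poly_Mapping.lookup g (m + m + ones)))"

lemma inj_double_add_ones: "inj (\<lambda>m :: 4 \<Rightarrow>\<^sub>0 nat. m + m + ones)"
proof (rule injI)
  fix m n :: "4 \<Rightarrow>\<^sub>0 nat"
  assume "m + m + ones = n + n + ones"
  then have "Poly_Mapping.lookup m i + Poly_Mapping.lookup m i
      = Poly_Mapping.lookup n i + Poly_Mapping.lookup n i" for i
    by (metis add_right_cancel lookup_add)
  then have "Poly_Mapping.lookup m i = Poly_Mapping.lookup n i" for i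
    by (metis mult_2 mult_cancel1 zero_neq_numeral)
  then show "m = n"
    by (rule poly_mapping_eqI)
qed

lemma lookup_cartier:
  "Poly_Mapping.lookup (cartier g) m = square_root (Poly_Mapping.lookup g (m + m + ones))"
proof -
  have "finite ((\<lambda>m. m + m + ones) -` Poly_Mapping.keys g)"
    by (intro finite_vimageI inj_double_add_ones) simp
  then have "finite {m. square_root (Poly_Mapping.lookup g (m + m + ones)) \<noteq> 0}"
    by (rule rev_finite_subset) (auto simp: in_keys_iff intro: ccontr)
  then show ?thesis
    by (simp add: cartier_def)
qed

lemma cartier_add:
  fixes g h :: "'k::alg_closed_field poly4"
  assumes "CHAR('k) = 2"
  shows "cartier (g + h) = cartier g + cartier h"
  by (rule poly_mapping_eqI) (simp add: lookup_cartier lookup_add square_root_add[OF assms])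

lemma cartier_single_double_add_ones:
  "cartier (Poly_Mapping.single (m + m + ones) c) = Poly_Mapping.single m (square_root c)"
proof -
  have "m + m + ones = n + n + ones \<longleftrightarrow> m = n" for n
    using injD[OF inj_double_add_ones, of m n] by auto
  then show ?thesis
    by (intro poly_mapping_eqI)
      (simp only: lookup_cartier lookup_single when_def square_root_0 split: if_splits, simp)
qed

lemma cartier_single_other:
  assumes "\<And>m. n \<noteq> m + m + ones"
  shows "cartier (Poly_Mapping.single n c) = 0"
  by (rule poly_mapping_eqI) (simp add: lookup_cartier lookup_single when_def assms)

text \<open>
  Both sides are additive in \<open>a\<close>, because squaring is, and in \<open>g\<close>.  It is therefore enough to treat
  monomials, where adding an even exponent does not change which exponents are odd.
\<close>

lemma cartier_square_mult:
  fixes a g :: "'k::alg_closed_field poly4"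
  assumes char: "CHAR('k) = 2"
  shows "cartier (a\<^sup>2 * g) = a * cartier g"
proof (induction a rule: poly4_induct)
  case (single n c)
  show ?case
  proof (induction g rule: poly4_induct)
    case (single k d)
    have eq: "(Poly_Mapping.single n c)\<^sup>2 * Poly_Mapping.single k d
        = Poly_Mapping.single (n + n + k) (c\<^sup>2 * d)"
      by (simp add: power2_eq_square mult_single)
    show ?case
    proof (cases "\<exists>j. k = j + j + ones")
      case True
      then obtain j where j: "k = j + j + ones" ..
      have "n + n + k = (n + j) + (n + j) + ones"
        unfolding j by (simp add: ac_simps)
      then show ?thesis
        unfolding eq
        by (simp only: cartier_single_double_add_ones j mult_single square_root_mult[OF char])
    next
      case False
      have "n + n + k \<noteq> m + m + ones" for m
      proof
        assume "n + n + k = m + m + ones"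
        then have i: "2 * Poly_Mapping.lookup n i + Poly_Mapping.lookup k i
            = 2 * Poly_Mapping.lookup m i + 1" for i
          by (metis lookup_add lookup_ones mult_2)
        have "k = (m - n) + (m - n) + ones"
        proof (rule poly_mapping_eqI)
          fix i
          show "Poly_Mapping.lookup k i = Poly_Mapping.lookup ((m - n) + (m - n) + ones) i"
            using i[of i] by (simp add: lookup_add minus_poly_mapping.rep_eq) arith
        qed
        then show False using False by blast
      qed
      then show ?thesis
        using False by (simp add: eq cartier_single_other)
    qed
  qed (simp add: algebra_simps cartier_add[OF char])
next
  case (add p q)
  then show ?case
    by (simp only: distrib_right cartier_add[OF char] square_add[OF two_eq_0_poly4[OF char]])
qed

text \<open>
  The shift by 4 is the degree of the product of all variables, which the operator divides out before
  it takes the square root.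
\<close>

lemma homogeneous_cartier:
  assumes "homogeneous (2 * d + 4) g"
  shows "homogeneous d (cartier g)"
  unfolding homogeneous_def
proof
  fix m
  assume "m \<in> Poly_Mapping.keys (cartier g)"
  then have "m + m + ones \<in> Poly_Mapping.keys g"
    by (auto simp: in_keys_iff lookup_cartier)
  then have "(\<Sum>i\<in>UNIV. Poly_Mapping.lookup (m + m + ones) i) = 2 * d + 4"
    using assms by (auto simp: homogeneous_def)
  then show "(\<Sum>i\<in>UNIV. Poly_Mapping.lookup m i) = d"
    by (simp add: lookup_add sum_4)
qed

section \<open>Germs and sections\<close>

lemma Proj_points_prime:
  assumes "P \<in> Proj_points f" "a \<notin> P" "b \<notin> P"
  shows "a * b \<notin> P"
proof -
  interpret primeideal P poly_ring
    using assms(1) by (simp add: Proj_points_def)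
  show ?thesis
    using I_prime[of a b] assms(2,3) by (auto simp: poly_ring_def)
qed

lemma Proj_points_one:
  assumes "P \<in> Proj_points f"
  shows "1 \<notin> P"
proof
  interpret primeideal P poly_ring
    using assms by (simp add: Proj_points_def)
  assume "1 \<in> P"
  then have "carrier poly_ring = P"
    using I_l_closed[of 1] by (auto simp: poly_ring_def)
  with I_notcarr show False by simp
qed

text \<open>
  The condition in the definition of \<open>germ\<close> that makes \<open>a/b\<close> and \<open>c/d\<close> equal in the localization at \<open>P\<close>.
\<close>

definition equal_germs ::
  "'k::comm_ring_1 poly4 \<Rightarrow> 'k poly4 set \<Rightarrow> 'k poly4 \<Rightarrow> 'k poly4 \<Rightarrow> 'k poly4 \<Rightarrow> 'k poly4 \<Rightarrow> bool" where
  "equal_germs f P a b c d \<longleftrightarrow> (\<exists>t e. homogeneous e t \<and> t \<notin> P \<and> f dvd t * (a * d - c * b))"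

text \<open>
  The condition for \<open>a/b\<close> to be an element of degree zero of the localization at \<open>P\<close>.
\<close>

definition fraction :: "'k::comm_ring_1 poly4 set \<Rightarrow> 'k poly4 \<Rightarrow> 'k poly4 \<Rightarrow> bool" where
  "fraction P a b \<longleftrightarrow> (\<exists>d. homogeneous d a \<and> homogeneous d b) \<and> b \<notin> P"

lemma mem_germ_iff: "(c, d) \<in> germ f P a b \<longleftrightarrow> fraction P c d \<and> equal_germs f P a b c d"
  by (auto simp: germ_def fraction_def equal_germs_def)

lemma equal_germs_sym: "equal_germs f P a b c d \<Longrightarrow> equal_germs f P c d a b"
  unfolding equal_germs_def by (metis dvd_minus_iff minus_diff_eq mult_minus_right)

text \<open>
  The usual argument for localizations: the middle denominator is absorbed into the multiplier,
  which stays outside of \<open>P\<close> because \<open>P\<close> is prime.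
\<close>

lemma equal_germs_trans:
  assumes P: "P \<in> Proj_points f" and "fraction P b' b"
    and "equal_germs f P c d a b" "equal_germs f P a b x y"
  shows "equal_germs f P c d x y"
proof -
  from assms(3) obtain t e where t: "homogeneous e t" "t \<notin> P" "f dvd t * (c * b - a * d)"
    unfolding equal_germs_def by auto
  from assms(4) obtain u e' where u: "homogeneous e' u" "u \<notin> P" "f dvd u * (a * y - x * b)"
    unfolding equal_germs_def by auto
  obtain n where b: "homogeneous n b" "b \<notin> P"
    using assms(2) by (auto simp: fraction_def)
  have "f dvd u * y * (t * (c * b - a * d)) + t * d * (u * (a * y - x * b))"
    by (rule dvd_add[OF dvd_mult[OF t(3)] dvd_mult[OF u(3)]])
  also have "\<dots> = (t * u * b) * (c * y - x * d)"
    by (simp add: algebra_simps)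
  finally show ?thesis
    unfolding equal_germs_def
    using homogeneous_mult[OF homogeneous_mult[OF t(1) u(1)] b(1)]
      Proj_points_prime[OF P Proj_points_prime[OF P t(2) u(2)] b(2)] by blast
qed

lemma germ_eqI:
  assumes P: "P \<in> Proj_points f" and ab: "fraction P a b" and cd: "fraction P c d"
    and eq: "equal_germs f P a b c d"
  shows "germ f P a b = germ f P c d"
proof -
  have "(x, y) \<in> germ f P a b \<longleftrightarrow> (x, y) \<in> germ f P c d" for x y
    using equal_germs_trans[OF P ab equal_germs_sym[OF eq]] equal_germs_trans[OF P cd eq]
    by (auto simp: mem_germ_iff)
  then show ?thesis by auto
qed

lemma equal_germsI:
  assumes P: "P \<in> Proj_points f" and "a * d = c * b"
  shows "equal_germs f P a b c d"
  unfolding equal_germs_def using Proj_points_one[OF P] homogeneous_one assms(2)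
  by (intro exI[of _ 1] exI[of _ 0]) auto

lemma fraction_self_mem: "P \<in> Proj_points f \<Longrightarrow> fraction P a b \<Longrightarrow> (a, b) \<in> germ f P a b"
  by (simp add: mem_germ_iff equal_germsI)

lemma fraction_mult:
  assumes "P \<in> Proj_points f" "fraction P a b" "fraction P c d"
  shows "fraction P (a * c) (b * d)"
  using assms homogeneous_mult Proj_points_prime unfolding fraction_def by metis

lemma fraction_add:
  assumes "P \<in> Proj_points f" "fraction P a b" "fraction P c d"
  shows "fraction P (a * d + c * b) (b * d)"
proof -
  obtain m n where "homogeneous m a" "homogeneous m b" "homogeneous n c" "homogeneous n d"
    using assms by (auto simp: fraction_def)
  then have "homogeneous (m + n) (a * d + c * b)" "homogeneous (m + n) (b * d)"
    using homogeneous_mult[of m a n d] homogeneous_mult[of n c m b] homogeneous_mult[of m b n d]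
    by (auto intro!: homogeneous_add simp: add.commute)
  then show ?thesis
    using assms Proj_points_prime unfolding fraction_def by blast
qed

lemma equal_germs_mult:
  assumes P: "P \<in> Proj_points f" and "equal_germs f P a b a' b'" "equal_germs f P c d c' d'"
  shows "equal_germs f P (a * c) (b * d) (a' * c') (b' * d')"
proof -
  from assms(2) obtain t e where t: "homogeneous e t" "t \<notin> P" "f dvd t * (a * b' - a' * b)"
    unfolding equal_germs_def by auto
  from assms(3) obtain u e' where u: "homogeneous e' u" "u \<notin> P" "f dvd u * (c * d' - c' * d)"
    unfolding equal_germs_def by auto
  have "f dvd u * c * d' * (t * (a * b' - a' * b)) + t * a' * b * (u * (c * d' - c' * d))"
    by (rule dvd_add[OF dvd_mult[OF t(3)] dvd_mult[OF u(3)]])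
  also have "\<dots> = (t * u) * ((a * c) * (b' * d') - (a' * c') * (b * d))"
    by (simp add: algebra_simps)
  finally show ?thesis
    unfolding equal_germs_def
    using homogeneous_mult[OF t(1) u(1)] Proj_points_prime[OF P t(2) u(2)] by blast
qed

lemma equal_germs_add:
  assumes P: "P \<in> Proj_points f" and "equal_germs f P a b a' b'" "equal_germs f P c d c' d'"
  shows "equal_germs f P (a * d + c * b) (b * d) (a' * d' + c' * b') (b' * d')"
proof -
  from assms(2) obtain t e where t: "homogeneous e t" "t \<notin> P" "f dvd t * (a * b' - a' * b)"
    unfolding equal_germs_def by auto
  from assms(3) obtain u e' where u: "homogeneous e' u" "u \<notin> P" "f dvd u * (c * d' - c' * d)"
    unfolding equal_germs_def by auto
  have "f dvd u * d * d' * (t * (a * b' - a' * b)) + t * b * b' * (u * (c * d' - c' * d))"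
    by (rule dvd_add[OF dvd_mult[OF t(3)] dvd_mult[OF u(3)]])
  also have "\<dots> = (t * u) * ((a * d + c * b) * (b' * d') - (a' * d' + c' * b') * (b * d))"
    by (simp add: algebra_simps)
  finally show ?thesis
    unfolding equal_germs_def
    using homogeneous_mult[OF t(1) u(1)] Proj_points_prime[OF P t(2) u(2)] by blast
qed

lemma germ_mult_germ:
  assumes P: "P \<in> Proj_points f" and ab: "fraction P a b" and cd: "fraction P c d"
  shows "germ_mult f P (germ f P a b) (germ f P c d) = germ f P (a * c) (b * d)"
proof -
  have "germ f P (a' * c') (b' * d') = germ f P (a * c) (b * d)"
    if "(a', b') \<in> germ f P a b" "(c', d') \<in> germ f P c d" for a' b' c' d'
    using that P ab cd
    by (intro germ_eqI fraction_mult equal_germs_mult) (auto simp: mem_germ_iff equal_germs_sym)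
  then show ?thesis
    unfolding germ_mult_def using fraction_self_mem[OF P ab] fraction_self_mem[OF P cd] by fast
qed

lemma germ_add_germ:
  assumes P: "P \<in> Proj_points f" and ab: "fraction P a b" and cd: "fraction P c d"
  shows "germ_add f P (germ f P a b) (germ f P c d) = germ f P (a * d + c * b) (b * d)"
proof -
  have "germ f P (a' * d' + c' * b') (b' * d') = germ f P (a * d + c * b) (b * d)"
    if "(a', b') \<in> germ f P a b" "(c', d') \<in> germ f P c d" for a' b' c' d'
    using that P ab cd
    by (intro germ_eqI fraction_add equal_germs_add) (auto simp: mem_germ_iff equal_germs_sym)
  then show ?thesis
    unfolding germ_add_def using fraction_self_mem[OF P ab] fraction_self_mem[OF P cd] by fast
qed

lemma openin_Proj_top_subset: "openin (Proj_top f) U \<Longrightarrow> U \<subseteq> Proj_points f"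
  by (auto simp: openin_Proj_top)

lemma sections_germ:
  assumes "s \<in> sections f U" "P \<in> U"
  obtains a b where "fraction P a b" "s P = germ f P a b"
  using assms unfolding sections_def fraction_def by blast

section \<open>From a splitting of the coordinate ring to a splitting of the structure sheaf\<close>

text \<open>
  A splitting of the Frobenius of \<open>S/(f)\<close>, lifted to the polynomial ring \<open>S\<close>, that halves degrees.  The
  last property is what makes it act on the degree zero parts of homogeneous localizations.
\<close>

locale graded_frobenius_splitting =
  fixes f :: "'k::comm_ring_1 poly4" and \<phi> :: "'k poly4 \<Rightarrow> 'k poly4"
  assumes char: "CHAR('k) = 2"
    and add: "\<phi> (a + b) = \<phi> a + \<phi> b"
    and square_mult: "\<phi> (a\<^sup>2 * b) = a * \<phi> b"
    and one: "\<phi> 1 = 1"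
    and dvd: "f dvd a \<Longrightarrow> f dvd \<phi> a"
    and homogeneous: "homogeneous (2 * d) a \<Longrightarrow> homogeneous d (\<phi> a)"
begin

text \<open>
  A fraction \<open>a/b\<close> equals \<open>ab/b\<^sup>2\<close>, so that linearity over squares forces its image to be \<open>\<phi>(ab)/b\<close>.
\<close>

definition germ_map :: "'k poly4 set \<Rightarrow> 'k germ \<Rightarrow> 'k germ" where
  "germ_map P x = (\<Union>(a, b)\<in>x. germ f P (\<phi> (a * b)) b)"

lemma diff: "\<phi> (a - b) = \<phi> a - \<phi> b"
  using add[of "a - b" b] by (simp add: algebra_simps)

lemma fraction_map: "fraction P a b \<Longrightarrow> fraction P (\<phi> (a * b)) b"
  unfolding fraction_def using homogeneous homogeneous_mult by (metis mult_2)

text \<open>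
  A multiplier \<open>t\<close> that witnesses \<open>a/b = c/d\<close> also witnesses equality of the images: move \<open>t\<close>, \<open>b\<close> and \<open>d\<close>
  into the argument of \<open>\<phi>\<close> as squares; the argument is then a multiple of \<open>t(ad - cb)\<close>, hence of \<open>f\<close>.
\<close>

lemma equal_germs_map:
  assumes "equal_germs f P a b c d"
  shows "equal_germs f P (\<phi> (a * b)) b (\<phi> (c * d)) d"
proof -
  from assms obtain t e where t: "homogeneous e t" "t \<notin> P" "f dvd t * (a * d - c * b)"
    unfolding equal_germs_def by auto
  have "t * (\<phi> (a * b) * d - \<phi> (c * d) * b) = \<phi> ((t * d)\<^sup>2 * (a * b)) - \<phi> ((t * b)\<^sup>2 * (c * d))"
    by (simp only: square_mult) (simp add: algebra_simps)
  also have "\<dots> = \<phi> ((t * b * d) * (t * (a * d - c * b)))"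
    unfolding diff[symmetric] by (simp add: power2_eq_square algebra_simps)
  finally have "f dvd t * (\<phi> (a * b) * d - \<phi> (c * d) * b)"
    using t(3) by (simp add: dvd)
  with t show ?thesis unfolding equal_germs_def by blast
qed

lemma germ_map_germ:
  assumes P: "P \<in> Proj_points f" and ab: "fraction P a b"
  shows "germ_map P (germ f P a b) = germ f P (\<phi> (a * b)) b"
proof -
  have "germ f P (\<phi> (a' * b')) b' = germ f P (\<phi> (a * b)) b" if "(a', b') \<in> germ f P a b" for a' b'
    using that P ab by (intro germ_eqI fraction_map equal_germs_map) (auto simp: mem_germ_iff equal_germs_sym)
  then show ?thesis
    unfolding germ_map_def using fraction_self_mem[OF P ab] by fast
qed

lemma germ_map_sections:
  assumes U: "openin (Proj_top f) U" and s: "s \<in> sections f U"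
  shows "(\<lambda>P\<in>U. germ_map P (s P)) \<in> sections f U"
  unfolding sections_def
proof (intro CollectI conjI ballI)
  fix P
  assume "P \<in> U"
  with s obtain V a b d where V: "openin (Proj_top f) V" "P \<in> V" "V \<subseteq> U"
    and d: "homogeneous d a" "homogeneous d b" and *: "\<forall>Q\<in>V. b \<notin> Q \<and> s Q = germ f Q a b"
    unfolding sections_def by blast
  have "homogeneous d (\<phi> (a * b))"
    using homogeneous homogeneous_mult[OF d] by (simp add: mult_2)
  moreover have "b \<notin> Q \<and> (\<lambda>P\<in>U. germ_map P (s P)) Q = germ f Q (\<phi> (a * b)) b" if "Q \<in> V" for Q
  proof -
    have "Q \<in> Proj_points f"
      using that openin_Proj_top_subset[OF V(1)] by blast
    moreover have "fraction Q a b"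
      using that * d by (auto simp: fraction_def)
    ultimately show ?thesis
      using germ_map_germ[of Q a b] that * V(3) by auto
  qed
  ultimately show "\<exists>V a b d. openin (Proj_top f) V \<and> P \<in> V \<and> V \<subseteq> U \<and>
      homogeneous d a \<and> homogeneous d b \<and>
      (\<forall>Q\<in>V. b \<notin> Q \<and> (\<lambda>P\<in>U. germ_map P (s P)) Q = germ f Q a b)"
    using V d(2) by blast
qed simp

lemma germ_map_add:
  assumes P: "P \<in> Proj_points f" and ab: "fraction P a b" and cd: "fraction P c d"
  shows "germ_map P (germ_add f P (germ f P a b) (germ f P c d)) =
    germ_add f P (germ_map P (germ f P a b)) (germ_map P (germ f P c d))"
proof -
  have "\<phi> ((a * d + c * b) * (b * d)) = \<phi> (d\<^sup>2 * (a * b)) + \<phi> (b\<^sup>2 * (c * d))"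
    unfolding add[symmetric] by (simp add: power2_eq_square algebra_simps)
  also have "\<dots> = \<phi> (a * b) * d + \<phi> (c * d) * b"
    by (simp only: square_mult) (simp add: algebra_simps)
  finally show ?thesis
    using assms by (simp add: germ_add_germ germ_map_germ fraction_add fraction_map)
qed

lemma germ_map_square_mult:
  assumes P: "P \<in> Proj_points f" and ab: "fraction P a b" and cd: "fraction P c d"
  shows "germ_map P (germ f P (a * a * c) (b * b * d)) =
    germ_mult f P (germ f P a b) (germ_map P (germ f P c d))"
proof -
  have "a * a * c * (b * b * d) = (a * b)\<^sup>2 * (c * d)"
    by (simp add: power2_eq_square algebra_simps)
  then have "\<phi> (a * a * c * (b * b * d)) = a * b * \<phi> (c * d)"
    by (simp only: square_mult)
  then have "germ_map P (germ f P (a * a * c) (b * b * d)) = germ f P (a * b * \<phi> (c * d)) (b * b * d)"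
    using germ_map_germ[OF P fraction_mult[OF P fraction_mult[OF P ab ab] cd]] by simp
  also have "\<dots> = germ f P (a * \<phi> (c * d)) (b * d)"
  proof (rule germ_eqI[OF P])
    show "fraction P (a * b * \<phi> (c * d)) (b * b * d)"
      using fraction_map[OF fraction_mult[OF P fraction_mult[OF P ab ab] cd]]
        \<open>\<phi> (a * a * c * (b * b * d)) = a * b * \<phi> (c * d)\<close> by simp
    show "fraction P (a * \<phi> (c * d)) (b * d)"
      by (intro fraction_mult[OF P] ab fraction_map cd)
  qed (auto intro!: equal_germsI[OF P])
  finally show ?thesis
    using assms by (simp add: germ_map_germ germ_mult_germ fraction_map)
qed

lemma germ_map_square:
  assumes P: "P \<in> Proj_points f" and ab: "fraction P a b"
  shows "germ_map P (germ f P (a * a) (b * b)) = germ f P a b"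
proof -
  have "fraction P 1 1"
    using homogeneous_one Proj_points_one[OF P] by (auto simp: fraction_def)
  then show ?thesis
    using germ_map_square_mult[OF P ab, of 1 1] germ_map_germ[OF P, of 1 1]
      germ_mult_germ[OF P ab, of 1 1] by (simp add: one)
qed

text \<open>
  The maps on stalks assemble to a map of sheaves because \<open>\<phi>(ab)/b\<close> represents the image of a section
  wherever \<open>a/b\<close> represents the section.  The algebraic conditions can be checked on germs.
\<close>

theorem surface_frobenius_split: "surface_frobenius_split f"
proof -
  let ?\<O> = "structure_sheaf f"
  define \<Phi> where "\<Phi> U s = (\<lambda>P\<in>U. germ_map P (s P))" for U and s :: "'k poly4 set \<Rightarrow> 'k germ"
  have square: "(s [^]\<^bsub>?\<O> U\<^esub> (2::nat)) P = germ f P (a * a) (b * b)"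
    if "P \<in> U" "P \<in> Proj_points f" "fraction P a b" "s P = germ f P a b" for U s P a b
  proof -
    have "fraction P 1 1"
      using homogeneous_one Proj_points_one[OF that(2)] by (auto simp: fraction_def)
    with that show ?thesis
      by (simp add: numeral_2_eq_2 nat_pow_def structure_sheaf_def germ_mult_germ fraction_mult)
  qed
  have maps: "\<Phi> U \<in> carrier (?\<O> U) \<rightarrow> carrier (?\<O> U)" if "openin (Proj_top f) U" for U
    using germ_map_sections[OF that] by (simp add: structure_sheaf_def \<Phi>_def)
  have plus: "\<Phi> U (s \<oplus>\<^bsub>?\<O> U\<^esub> t) = \<Phi> U s \<oplus>\<^bsub>?\<O> U\<^esub> \<Phi> U t"
    if U: "openin (Proj_top f) U" and st: "s \<in> sections f U" "t \<in> sections f U" for U s t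
  proof -
    have "germ_map P (germ_add f P (s P) (t P)) = germ_add f P (germ_map P (s P)) (germ_map P (t P))"
      if PU: "P \<in> U" for P
    proof -
      have P: "P \<in> Proj_points f"
        using PU openin_Proj_top_subset[OF U] by blast
      obtain a b where "fraction P a b" "s P = germ f P a b"
        using sections_germ[OF st(1) PU] .
      moreover obtain c d where "fraction P c d" "t P = germ f P c d"
        using sections_germ[OF st(2) PU] .
      ultimately show ?thesis
        using germ_map_add[OF P] by simp
    qed
    then show ?thesis
      by (auto simp: structure_sheaf_def \<Phi>_def fun_eq_iff)
  qed
  have linear: "\<Phi> U ((s [^]\<^bsub>?\<O> U\<^esub> (2::nat)) \<otimes>\<^bsub>?\<O> U\<^esub> t) = s \<otimes>\<^bsub>?\<O> U\<^esub> \<Phi> U t"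
    if U: "openin (Proj_top f) U" and st: "s \<in> sections f U" "t \<in> sections f U" for U s t
  proof -
    have "germ_map P (germ_mult f P ((s [^]\<^bsub>?\<O> U\<^esub> (2::nat)) P) (t P))
        = germ_mult f P (s P) (germ_map P (t P))" if PU: "P \<in> U" for P
    proof -
      have P: "P \<in> Proj_points f"
        using PU openin_Proj_top_subset[OF U] by blast
      obtain a b where ab: "fraction P a b" "s P = germ f P a b"
        using sections_germ[OF st(1) PU] .
      moreover obtain c d where cd: "fraction P c d" "t P = germ f P c d"
        using sections_germ[OF st(2) PU] .
      ultimately show ?thesis
        using germ_map_square_mult[OF P ab(1) cd(1)]
          germ_mult_germ[OF P fraction_mult[OF P ab(1) ab(1)] cd(1)] square[of P U a b s, OF PU P ab] by simp
    qed
    then show ?thesis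
      by (auto simp: structure_sheaf_def \<Phi>_def fun_eq_iff)
  qed
  have split: "\<Phi> U (s [^]\<^bsub>?\<O> U\<^esub> (2::nat)) = s"
    if U: "openin (Proj_top f) U" and s: "s \<in> sections f U" for U s
  proof
    fix P
    show "\<Phi> U (s [^]\<^bsub>?\<O> U\<^esub> (2::nat)) P = s P"
    proof (cases "P \<in> U")
      case True
      then have P: "P \<in> Proj_points f"
        using openin_Proj_top_subset[OF U] by blast
      obtain a b where ab: "fraction P a b" "s P = germ f P a b"
        using sections_germ[OF s True] .
      then show ?thesis
        using germ_map_square[OF P ab(1)] square[of P U a b s, OF True P ab] True by (simp add: \<Phi>_def)
    next
      case False
      then show ?thesis
        using s by (simp add: \<Phi>_def sections_def extensional_def)
    qed
  qed
  have restrict: "\<Phi> V (restrict s V) = restrict (\<Phi> U s) V" if "V \<subseteq> U" for U V s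
    using that by (auto simp: \<Phi>_def fun_eq_iff)
  show ?thesis
    unfolding surface_frobenius_split_def frobenius_split_def char
    using maps plus linear split restrict
    by (intro exI[of _ \<Phi>]) (simp add: structure_sheaf_def)
qed

end

section \<open>Frobenius split cubic surfaces\<close>

lemma lookup_mult_single:
  fixes p :: "'k::comm_ring_1 poly4"
  shows "Poly_Mapping.lookup (p * Poly_Mapping.single n d) (k + n) = Poly_Mapping.lookup p k * d"
proof (induction p rule: poly4_induct)
  case (single m c)
  show ?case
    by (simp add: mult_single lookup_single when_def)
qed (simp add: distrib_right lookup_add)

text \<open>
  Fedder's criterion in the only case that is needed.  If \<open>f\<close> contains a monomial \<open>m\<close> that is the
  product of all variables but \<open>x\<^sub>l\<close>, let \<open>s\<close> be \<open>x\<^sub>l\<close> divided by the coefficient of \<open>m\<close>.  The map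
  \<open>g \<mapsto> cartier (f s g)\<close> preserves the multiples of \<open>f\<close>, since \<open>f s (f r) = f\<^sup>2 s r\<close>, and sends 1 to 1: the
  form \<open>f s\<close> has degree 4, so that its image is constant, namely the root of its coefficient at the
  product of all variables.
\<close>

lemma surface_frobenius_split_if_squarefree_monomial:
  fixes f :: "'k::alg_closed_field poly4"
  assumes char: "CHAR('k) = 2" and f: "homogeneous 3 f"
    and m: "m + Poly_Mapping.single l 1 = ones" "Poly_Mapping.lookup f m \<noteq> 0"
  shows "surface_frobenius_split f"
proof -
  define s :: "'k poly4" where
    "s = Poly_Mapping.single (Poly_Mapping.single l 1) (inverse (Poly_Mapping.lookup f m))"
  have s: "homogeneous 1 s"
    by (simp add: homogeneous_def s_def lookup_single when_def)
  have fs: "homogeneous 4 (f * s)"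
    using homogeneous_mult[OF f s] by simp
  have "cartier (f * s) = 1"
  proof (rule poly_mapping_eqI)
    fix n
    have 0: "homogeneous 0 (cartier (f * s))"
      using homogeneous_cartier[of 0 "f * s"] fs by simp
    show "Poly_Mapping.lookup (cartier (f * s)) n = Poly_Mapping.lookup 1 n"
    proof (cases "n = 0")
      case True
      have "Poly_Mapping.lookup (f * s) ones = 1"
        unfolding m(1)[symmetric] s_def lookup_mult_single using m(2) by simp
      then show ?thesis
        by (simp add: True lookup_cartier square_root_1[OF char])
    next
      case False
      then obtain i where "Poly_Mapping.lookup n i \<noteq> 0"
        by (metis lookup_zero poly_mapping_eqI)
      then have "n \<notin> Poly_Mapping.keys (cartier (f * s))"
        using 0 by (auto simp: homogeneous_def)
      then show ?thesis
        using False by (simp add: in_keys_iff lookup_one when_def)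
    qed
  qed
  then interpret graded_frobenius_splitting f "\<lambda>g. cartier (f * s * g)"
  proof unfold_locales
    fix a b :: "'k poly4" and d
    show "CHAR('k) = 2" by fact
    show "cartier (f * s * (a + b)) = cartier (f * s * a) + cartier (f * s * b)"
      by (simp add: distrib_left cartier_add[OF char])
    have "f * s * (a\<^sup>2 * b) = a\<^sup>2 * (f * s * b)"
      by (simp add: ac_simps)
    then show "cartier (f * s * (a\<^sup>2 * b)) = a * cartier (f * s * b)"
      by (simp only: cartier_square_mult[OF char])
    show "f dvd cartier (f * s * a)" if "f dvd a"
    proof -
      from that obtain r where "a = f * r" ..
      then have "f * s * a = f\<^sup>2 * (s * r)"
        by (simp add: power2_eq_square ac_simps)
      then show ?thesis
        by (simp only: cartier_square_mult[OF char] dvd_triv_left)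
    qed
    show "homogeneous d (cartier (f * s * a))" if "homogeneous (2 * d) a"
      using homogeneous_cartier homogeneous_mult[OF fs that] by (simp add: add.commute)
  qed simp
  show ?thesis
    by (rule surface_frobenius_split)
qed

section \<open>Combinations of squares\<close>

text \<open>
  When \<open>y\<close> is a coordinate system, these are the cubic forms in the ideal generated by the squares of
  the coordinates.
\<close>

definition square_combination :: "(4 \<Rightarrow> 4 \<Rightarrow> 'k::comm_ring_1) \<Rightarrow> (4 \<Rightarrow> 'k poly4) \<Rightarrow> 'k poly4" where
  "square_combination a y = (\<Sum>i\<in>UNIV. \<Sum>j\<in>UNIV. const (a i j) * (y i)\<^sup>2 * y j)"

lemma const_sum: "const (sum g A) = (\<Sum>x\<in>A. const (g x))"
  by (induction A rule: infinite_finite_induct) (simp_all add: single_add)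

lemma const_mult: "const (a * b) = const a * const b"
  by (simp add: mult_single)

lemma square_combination_sum:
  "(\<Sum>x\<in>A. square_combination (a x) y) = square_combination (\<lambda>i j. \<Sum>x\<in>A. a x i j) y"
proof (induction A rule: infinite_finite_induct)
  case (insert x A)
  then show ?case
    by (simp add: square_combination_def single_add distrib_right sum.distrib)
qed (simp_all add: square_combination_def)

lemma square_combination_scale:
  "const c * square_combination a y = square_combination (\<lambda>i j. c * a i j) y"
  by (simp add: square_combination_def sum_distrib_left const_mult mult.assoc)

lemma square_combination_unit:
  "square_combination (\<lambda>i j. if i = i0 \<and> j = j0 then c else 0) y = const c * (y i0)\<^sup>2 * y j0"
proof -
  have "square_combination (\<lambda>i j. if i = i0 \<and> j = j0 then c else 0) y =
      (\<Sum>i\<in>UNIV. \<Sum>j\<in>UNIV. if j = j0 then (if i = i0 then const c * (y i)\<^sup>2 * y j else 0) else 0)"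
    unfolding square_combination_def by (intro sum.cong) auto
  then show ?thesis
    by simp
qed

text \<open>
  If every exponent is at most 1, then exactly one of the four vanishes; otherwise removing the square
  of a variable leaves a monomial of degree 1.
\<close>

lemma cubic_monomial_cases:
  assumes "(\<Sum>i\<in>UNIV. Poly_Mapping.lookup m (i::4)) = (3::nat)"
  shows "(\<exists>l. m + Poly_Mapping.single l 1 = ones) \<or>
    (\<exists>i j. m = Poly_Mapping.single i 1 + Poly_Mapping.single i 1 + Poly_Mapping.single j 1)"
proof (cases "\<exists>i. Poly_Mapping.lookup m i \<ge> 2")
  case True
  then obtain i where i: "Poly_Mapping.lookup m i \<ge> 2" ..
  define n where "n = m - (Poly_Mapping.single i 1 + Poly_Mapping.single i 1)"
  have m: "m = Poly_Mapping.single i 1 + Poly_Mapping.single i 1 + n"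
  proof (rule poly_mapping_eqI)
    fix k
    show "Poly_Mapping.lookup m k =
        Poly_Mapping.lookup (Poly_Mapping.single i 1 + Poly_Mapping.single i 1 + n) k"
      using i by (cases "k = i")
        (simp_all add: n_def lookup_add minus_poly_mapping.rep_eq lookup_single when_def)
  qed
  have "(\<Sum>k\<in>UNIV. Poly_Mapping.lookup n k) = 1"
    using assms unfolding m by (simp add: lookup_add sum.distrib lookup_single when_def)
  then obtain j where j: "Poly_Mapping.lookup n j = 1" "\<forall>k. j \<noteq> k \<longrightarrow> Poly_Mapping.lookup n k = 0"
    using sum_eq_1_iff[of UNIV "Poly_Mapping.lookup n"] by auto
  have "n = Poly_Mapping.single j 1"
  proof (rule poly_mapping_eqI)
    fix k
    show "Poly_Mapping.lookup n k = Poly_Mapping.lookup (Poly_Mapping.single j 1) k"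
      using j by (cases "k = j") (simp_all add: lookup_single when_def)
  qed
  with m show ?thesis by blast
next
  case False
  have le: "Poly_Mapping.lookup m i \<le> 1" for i
  proof -
    have "\<not> 2 \<le> Poly_Mapping.lookup m i"
      using False by blast
    then show ?thesis by simp
  qed
  have "(\<Sum>i\<in>UNIV. 1 - Poly_Mapping.lookup m i) = (1::nat)"
    using assms le[of 1] le[of 2] le[of 3] le[of 4] by (simp add: sum_4)
  then obtain l where l: "1 - Poly_Mapping.lookup m l = 1"
    "\<forall>k. l \<noteq> k \<longrightarrow> 1 - Poly_Mapping.lookup m k = 0"
    using sum_eq_1_iff[of UNIV "\<lambda>i. 1 - Poly_Mapping.lookup m i"] by auto
  have "m + Poly_Mapping.single l 1 = ones"
  proof (rule poly_mapping_eqI)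
    fix k
    show "Poly_Mapping.lookup (m + Poly_Mapping.single l 1) k = Poly_Mapping.lookup ones k"
      using l le[of k] by (cases "k = l") (auto simp: lookup_add lookup_single when_def)
  qed
  then show ?thesis by blast
qed

lemma square_combination_if_no_squarefree_monomial:
  fixes f :: "'k::comm_ring_1 poly4"
  assumes f: "homogeneous 3 f"
    and no: "\<And>m l. m + Poly_Mapping.single l 1 = ones \<Longrightarrow> Poly_Mapping.lookup f m = 0"
  obtains a where "f = square_combination a var"
proof -
  have "\<exists>a. Poly_Mapping.single m (Poly_Mapping.lookup f m) = square_combination a var"
    if "m \<in> Poly_Mapping.keys f" for m
  proof -
    have "(\<Sum>i\<in>UNIV. Poly_Mapping.lookup m i) = 3"
      using f that by (auto simp: homogeneous_def)
    moreover have "m + Poly_Mapping.single l 1 \<noteq> ones" for l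
      using no that by (auto simp: in_keys_iff)
    ultimately obtain i j where
      m: "m = Poly_Mapping.single i 1 + Poly_Mapping.single i 1 + Poly_Mapping.single j 1"
      using cubic_monomial_cases by blast
    have "Poly_Mapping.single m c = const c * (var i)\<^sup>2 * var j" for c :: 'k
      by (simp add: m var_def power2_eq_square mult_single)
    then show ?thesis
      by (metis square_combination_unit)
  qed
  then obtain a where "\<And>m. m \<in> Poly_Mapping.keys f \<Longrightarrow>
      Poly_Mapping.single m (Poly_Mapping.lookup f m) = square_combination (a m) var"
    by metis
  then have "f = (\<Sum>m\<in>Poly_Mapping.keys f. square_combination (a m) var)"
    by (subst poly4_eq_sum_monomials) simp
  then show ?thesis
    using that unfolding square_combination_sum by blast
qed

text \<open>
  In characteristic two the square of a linear form is a combination of squares of coordinates.  Being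
  a combination of squares is therefore a property of the form alone, independent of coordinates.
\<close>

lemma square_combination_linear_change:
  fixes a :: "4 \<Rightarrow> 4 \<Rightarrow> 'k::comm_ring_1"
  assumes char: "CHAR('k) = 2" and x: "\<And>i. x i = (\<Sum>j\<in>UNIV. const (E i j) * y j)"
  obtains b where "square_combination a x = square_combination b y"
proof -
  have "(x i)\<^sup>2 * x l = square_combination (\<lambda>j k. (E i j)\<^sup>2 * E l k) y" for i l
  proof -
    have square: "(x i)\<^sup>2 = (\<Sum>j\<in>UNIV. const ((E i j)\<^sup>2) * (y j)\<^sup>2)"
      unfolding x square_sum[OF two_eq_0_poly4[OF char]]
      by (simp add: power_mult_distrib) (simp add: power2_eq_square const_mult)
    show ?thesis
      unfolding square unfolding x[of l] sum_product square_combination_def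
      by (simp add: const_mult ac_simps)
  qed
  then have "square_combination a x =
      (\<Sum>i\<in>UNIV. \<Sum>l\<in>UNIV. square_combination (\<lambda>j k. a i l * ((E i j)\<^sup>2 * E l k)) y)"
    unfolding square_combination_def[of a x] mult.assoc by (simp add: square_combination_scale)
  then show ?thesis
    using that unfolding square_combination_sum by blast
qed

section \<open>Linear coordinates\<close>

text \<open>
  A basis of the vector space with the linear forms that are its dual basis.
\<close>

locale linear_coordinates =
  fixes e :: "4 \<Rightarrow> 'k::field ^ 4" and y :: "4 \<Rightarrow> 'k poly4"
  assumes homogeneous_coordinate: "homogeneous 1 (y j)"
    and var_expansion: "var i = (\<Sum>j\<in>UNIV. const (e j $ i) * y j)"
    and linear: "Vector_Spaces.linear (*s) (*) (poly_eval (y j))"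
    and dual: "poly_eval (y j) (e k) = (if j = k then 1 else 0)"
    and inj: "inj e" and independent: "vec.independent (range e)"
begin

lemma vector_expansion: "v = (\<Sum>j\<in>UNIV. poly_eval (y j) v *s e j)"
proof -
  have "v $ i = (\<Sum>j\<in>UNIV. poly_eval (y j) v *s e j) $ i" for i
    using arg_cong[OF var_expansion[of i], of "\<lambda>p. poly_eval p v"] by (simp add: mult.commute)
  then show ?thesis
    by (simp add: vec_eq_iff)
qed

lemma subspace_zero_coordinates: "vec.subspace {v. \<forall>j\<in>J. poly_eval (y j) v = 0}"
proof -
  interpret y: Vector_Spaces.linear "(*s)" "(*)" "poly_eval (y j)" for j
    by (rule linear)
  show ?thesis
    by (auto simp: vec.subspace_def y.add y.scale y.zero)
qed

lemma span_coordinate_vectors: "vec.span (e ` I) = {v. \<forall>j\<in>- I. poly_eval (y j) v = 0}"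
proof
  show "vec.span (e ` I) \<subseteq> {v. \<forall>j\<in>- I. poly_eval (y j) v = 0}"
    by (rule vec.span_minimal[OF _ subspace_zero_coordinates]) (auto simp: dual)
  show "{v. \<forall>j\<in>- I. poly_eval (y j) v = 0} \<subseteq> vec.span (e ` I)"
  proof
    fix v
    assume v: "v \<in> {v. \<forall>j\<in>- I. poly_eval (y j) v = 0}"
    have "poly_eval (y j) v *s e j \<in> vec.span (e ` I)" for j
      using v by (cases "j \<in> I") (auto intro: vec.span_scale vec.span_base vec.span_zero)
    then have "(\<Sum>j\<in>UNIV. poly_eval (y j) v *s e j) \<in> vec.span (e ` I)"
      by (intro vec.span_sum)
    then show "v \<in> vec.span (e ` I)"
      by (subst vector_expansion)
  qed
qed

lemma dim_span_coordinate_vectors: "vec.dim (vec.span (e ` I)) = card I"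
proof -
  have "vec.independent (e ` I)"
    by (rule vec.independent_mono[OF independent]) auto
  then show ?thesis
    using inj by (simp add: vec.dim_span vec.dim_eq_card_independent card_image inj_on_subset)
qed

end

lemma linear_coordinates_exist:
  fixes e :: "4 \<Rightarrow> 'k::field ^ 4"
  assumes inj: "inj e" and indep: "vec.independent (range e)"
  obtains y where "linear_coordinates e y"
proof -
  define E :: "'k ^ 4 ^ 4" where "E = (\<chi> i j. e j $ i)"
  have column: "column j E = e j" for j
    by (simp add: column_def E_def vec_eq_iff)
  have "c i = 0" if "(\<Sum>i\<in>UNIV. c i *s column i E) = 0" for c i
  proof -
    have "(\<Sum>v\<in>range e. c (inv_into UNIV e v) *s v) = (\<Sum>i\<in>UNIV. c i *s e i)"
      by (simp add: sum.reindex[OF inj] inj)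
    also have "\<dots> = 0"
      using that by (simp only: column)
    finally have "c (inv_into UNIV e (e i)) = 0"
      by (rule vec.independentD[OF indep finite_imageI[OF finite] subset_refl,
            where u = "\<lambda>v. c (inv_into UNIV e v)"]) (rule rangeI)
    then show ?thesis
      by (simp add: inj)
  qed
  then have "\<exists>B. B ** E = mat 1"
    unfolding matrix_left_invertible_independent_columns by (intro allI impI) simp
  then obtain B where B: "B ** E = mat 1" ..
  then have B': "E ** B = mat 1"
    by (simp only: matrix_left_right_inverse)
  define y where "y j = (\<Sum>i\<in>UNIV. const (B $ j $ i) * var i)" for j
  have eval: "poly_eval (y j) v = (B *v v) $ j" for j v
    by (simp add: y_def matrix_vector_mult_def)
  have "linear_coordinates e y"
  proof (rule linear_coordinates.intro)
    fix i j k
    show "homogeneous 1 (y j)"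
      unfolding y_def by (intro homogeneous_sum homogeneous_const_mult homogeneous_var)
    have "(\<Sum>j\<in>UNIV. const (e j $ i) * y j) =
        (\<Sum>l\<in>UNIV. \<Sum>j\<in>UNIV. const (E $ i $ j * B $ j $ l) * var l)"
      unfolding y_def by (subst sum.swap) (simp add: sum_distrib_left const_mult E_def mult.assoc)
    also have "\<dots> = (\<Sum>l\<in>UNIV. const ((E ** B) $ i $ l) * var l)"
      by (simp add: matrix_matrix_mult_def const_sum sum_distrib_right)
    also have "\<dots> = (\<Sum>l\<in>UNIV. if l = i then var l else 0)"
      unfolding B' by (intro sum.cong) (auto simp: mat_def)
    finally show "var i = (\<Sum>j\<in>UNIV. const (e j $ i) * y j)"
      by simp
    show "Vector_Spaces.linear (*s) (*) (poly_eval (y j))"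
      by unfold_locales
        (simp_all add: eval matrix_vector_right_distrib vector_scalar_commute algebra_simps)
    have "B *v e k = axis k 1"
      using arg_cong[OF B, of "\<lambda>M. column k M"]
      by (simp add: vec_eq_iff column_def matrix_matrix_mult_def matrix_vector_mult_def E_def
          mat_def axis_def)
    then show "poly_eval (y j) (e k) = (if j = k then 1 else 0)"
      by (simp add: eval axis_def)
  qed (use inj indep in auto)
  then show ?thesis
    by (rule that)
qed

lemma subspace_dim_1E:
  fixes S :: "('k::field ^ 'n) set"
  assumes "vec.subspace S" "vec.dim S = 1"
  obtains u where "u \<noteq> 0" "S = vec.span {u}"
proof -
  have "\<not> S \<subseteq> {0}"
  proof
    assume "S \<subseteq> {0}"
    then have "vec.dim S \<le> vec.dim {0 :: 'k ^ 'n}"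
      by (rule vec.dim_subset)
    also have "\<dots> = 0"
      by (simp add: vec.dim_insert vec.span_empty)
    finally show False using assms by simp
  qed
  then obtain u where u: "u \<in> S" "u \<noteq> 0" by auto
  have "vec.dim (vec.span {u}) = 1"
    using u by (simp add: vec.dim_span vec.dim_eq_card_independent)
  then have "vec.span {u} = S"
    using u assms by (intro vec.subspace_dim_equal vec.subspace_span vec.span_minimal) auto
  with u show ?thesis using that by blast
qed

text \<open>
  The first basis vector spans the common point; the second and the third complete it to bases of the
  two lines, and the fourth lies outside of their plane.
\<close>

lemma coordinates_of_meeting_lines:
  fixes L M :: "('k::field ^ 4) set"
  assumes L: "proj_flat 1 L" and M: "proj_flat 1 M" and LM: "proj_flat 0 (L \<inter> M)"
  obtains e y where "linear_coordinates e y" "L \<inter> M = vec.span (e ` {1})"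
    "L = vec.span (e ` {1, 2})" "M = vec.span (e ` {1, 3})"
    "vec.span (L \<union> M) = vec.span (e ` {1, 2, 3})"
proof -
  have sub: "vec.subspace L" "vec.subspace M" "vec.subspace (L \<inter> M)"
    and dim: "vec.dim L = 2" "vec.dim M = 2" "vec.dim (L \<inter> M) = 1"
    using assms by (auto simp: proj_flat_def)
  obtain u where u: "u \<noteq> 0" "L \<inter> M = vec.span {u}"
    using subspace_dim_1E[OF sub(3) dim(3)] .
  then have uLM: "u \<in> L" "u \<in> M"
    using vec.span_base[of u "{u}"] by auto
  have "L \<noteq> L \<inter> M" "M \<noteq> L \<inter> M"
    using dim by auto
  then obtain v w where v: "v \<in> L" "v \<notin> M" and w: "w \<in> M" "w \<notin> L"
    by blast
  have spanE: "S = vec.span {u, x} \<and> vec.independent {u, x} \<and> u \<noteq> x"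
    if "vec.subspace S" "vec.dim S = 2" "u \<in> S" "x \<in> S" "x \<notin> L \<inter> M" for S x
  proof -
    have "x \<notin> vec.span {u}"
      using that(5) u(2) by simp
    moreover have "vec.independent {u}"
      using u(1) by simp
    ultimately have "vec.independent {x, u}"
      by (rule vec.independent_insertI)
    then have "vec.independent {u, x}"
      by (simp add: insert_commute)
    moreover have "u \<noteq> x"
      using that(5) uLM by blast
    ultimately have "vec.dim (vec.span {u, x}) = 2"
      using \<open>u \<noteq> x\<close> by (simp add: vec.dim_span vec.dim_eq_card_independent)
    then have "vec.span {u, x} = S"
      using that by (intro vec.subspace_dim_equal vec.subspace_span vec.span_minimal) auto
    with \<open>vec.independent {u, x}\<close> \<open>u \<noteq> x\<close> show ?thesis
      by simp
  qed
  have Lspan: "L = vec.span {u, v}" and uv: "vec.independent {u, v}" "u \<noteq> v"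
    using spanE[OF sub(1) dim(1) uLM(1) v(1)] v by auto
  have Mspan: "M = vec.span {u, w}"
    using spanE[OF sub(2) dim(2) uLM(2) w(1)] w by auto
  have wuv: "vec.independent {w, u, v}" "w \<notin> {u, v}"
    using w(2) uv vec.span_base[of w "{u, v}"] unfolding Lspan
    by (auto simp: vec.independent_insert)
  have "vec.dim {w, u, v} = 3"
    using wuv uv(2) by (simp add: vec.dim_eq_card_independent)
  moreover have "vec.dim (UNIV :: ('k ^ 4) set) = 4"
    by (subst vec_dim_card) simp
  ultimately have "vec.span {w, u, v} \<noteq> UNIV"
    by (metis vec.dim_span numeral_eq_iff semiring_norm(89))
  then obtain z where z: "z \<notin> vec.span {w, u, v}" by auto
  have zwuv: "vec.independent {z, w, u, v}" "z \<notin> {w, u, v}"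
    using z wuv vec.span_base[of z "{w, u, v}"] by (auto simp: vec.independent_insert)
  define e :: "4 \<Rightarrow> 'k ^ 4" where
    "e i = (if i = 1 then u else if i = 2 then v else if i = 3 then w else z)" for i
  have e: "e 1 = u" "e 2 = v" "e 3 = w" "e 4 = z"
    by (simp_all add: e_def)
  have range: "range e = {z, w, u, v}"
    by (auto simp: UNIV_4 e)
  have "card (range e) = 4"
    unfolding range using zwuv(2) wuv(2) uv(2) by simp
  then have "inj e"
    by (intro eq_card_imp_inj_on) auto
  then obtain y where y: "linear_coordinates e y"
    using linear_coordinates_exist zwuv(1) range by metis
  have "vec.span (L \<union> M) = vec.span {u, v, w}"
  proof
    have "L \<union> M \<subseteq> vec.span {u, v, w}"
      unfolding Lspan Mspan by (intro Un_least vec.span_mono) auto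
    then show "vec.span (L \<union> M) \<subseteq> vec.span {u, v, w}"
      by (intro vec.span_minimal vec.subspace_span)
    show "vec.span {u, v, w} \<subseteq> vec.span (L \<union> M)"
      using uLM v w by (intro vec.span_mono) auto
  qed
  with y show ?thesis
    using that[of e y] u Lspan Mspan by (simp add: e)
qed

section \<open>Sections by the plane of two meeting lines\<close>

text \<open>
  The values at \<open>(1,0)\<close>, \<open>(0,1)\<close> and \<open>(1,1)\<close> reduce the form to \<open>b s t (s - t)\<close>.  Its remaining
  coefficient can be detected only at a point outside of the prime field, and a primitive cube root of
  unity provides one.
\<close>

lemma binary_cubic_eq_0:
  fixes a b c d :: "'k::alg_closed_field"
  assumes char: "CHAR('k) = 2"
    and zero: "\<And>s t. a * s ^ 3 + b * s\<^sup>2 * t + c * t\<^sup>2 * s + d * t ^ 3 = 0"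
  shows "a = 0 \<and> b = 0 \<and> c = 0 \<and> d = 0"
proof -
  have a: "a = 0" and d: "d = 0"
    using zero[of 1 0] zero[of 0 1] by simp_all
  have "b + c = 0"
    using zero[of 1 1] a d by simp
  then have c: "c = - b"
    by (simp add: eq_neg_iff_add_eq_0 add.commute)
  obtain s :: 'k where "(\<Sum>i\<le>2. 1 * s ^ i) = 0"
    using alg_closed[of 2 "\<lambda>_. 1 :: 'k"] by auto
  then have s: "s\<^sup>2 = - 1 - s"
    by (simp add: numeral_2_eq_2 algebra_simps eq_neg_iff_add_eq_0)
  have "b * (s\<^sup>2 - s) = 0"
    using zero[of s 1] a d c by (simp add: algebra_simps)
  moreover have "s\<^sup>2 - s = - 1 - 2 * s"
    unfolding s by simp
  ultimately have "b * (- 1 - 2 * s) = 0"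
    by simp
  then have "b = 0"
    unfolding two_eq_0[OF char] by simp
  with a c d show ?thesis by simp
qed

lemma (in linear_coordinates) square_combination_mod_plane:
  fixes a :: "4 \<Rightarrow> 4 \<Rightarrow> 'k"
  assumes "a 1 1 = 0" "a 1 2 = 0" "a 2 1 = 0" "a 2 2 = 0" "a 1 3 = 0" "a 3 1 = 0" "a 3 3 = 0"
  shows "y 4 dvd square_combination a y - y 2 * y 3 * (const (a 2 3) * y 2 + const (a 3 2) * y 3)"
proof
  show "square_combination a y - y 2 * y 3 * (const (a 2 3) * y 2 + const (a 3 2) * y 3) =
    y 4 * ((\<Sum>k\<in>UNIV. const (a 4 k) * y 4 * y k) + const (a 1 4) * (y 1)\<^sup>2
      + const (a 2 4) * (y 2)\<^sup>2 + const (a 3 4) * (y 3)\<^sup>2)"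
    by (simp add: square_combination_def sum_4 assms power2_eq_square algebra_simps)
qed

text \<open>
  This is where the failure of Frobenius splitting enters.  It turns \<open>f\<close> into a combination of squares
  in every system of coordinates, so that the monomial \<open>y\<^sub>1 y\<^sub>2 y\<^sub>3\<close> does not occur.  The
  restriction of \<open>f\<close> to the plane of the two lines is \<open>y\<^sub>2 y\<^sub>3\<close> times a linear form, which is
  then free of \<open>y\<^sub>1\<close>: the residual line passes through the intersection of the two lines.
\<close>

lemma plane_section_of_meeting_lines:
  fixes f :: "'k::alg_closed_field poly4"
  assumes char: "CHAR('k) = 2" and f: "homogeneous 3 f" "\<not> surface_frobenius_split f"
    and L: "line_on f L" and M: "line_on f M" and LM: "proj_flat 0 (L \<inter> M)"
  obtains e y b c where "linear_coordinates e y" "L \<inter> M = vec.span (e ` {1})"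
    "L = vec.span (e ` {1, 2})" "M = vec.span (e ` {1, 3})"
    "vec.span (L \<union> M) = vec.span (e ` {1, 2, 3})"
    "y 4 dvd f - y 2 * y 3 * (const b * y 2 + const c * y 3)"
proof -
  have L': "proj_flat 1 L" "L \<subseteq> zeros f" and M': "proj_flat 1 M" "M \<subseteq> zeros f"
    using L M by (auto simp: line_on_def)
  obtain e y where y: "linear_coordinates e y" and
    spans: "L \<inter> M = vec.span (e ` {1})" "L = vec.span (e ` {1, 2})" "M = vec.span (e ` {1, 3})"
    "vec.span (L \<union> M) = vec.span (e ` {1, 2, 3})"
    using coordinates_of_meeting_lines[OF L'(1) M'(1) LM] .
  interpret linear_coordinates e y by fact
  interpret lin: Vector_Spaces.linear "(*s)" "(*)" "poly_eval (y j)" for j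
    by (rule linear)
  have "Poly_Mapping.lookup f m = 0" if "m + Poly_Mapping.single l 1 = ones" for m l
    using surface_frobenius_split_if_squarefree_monomial[OF char f(1) that] f(2) by blast
  then obtain a0 where a0: "f = square_combination a0 var"
    by (rule square_combination_if_no_squarefree_monomial[OF f(1)])
  obtain a where "square_combination a0 var = square_combination a y"
    by (rule square_combination_linear_change[OF char var_expansion])
  with a0 have a: "f = square_combination a y"
    by simp
  have eval: "poly_eval f v = (\<Sum>i\<in>UNIV. \<Sum>j\<in>UNIV. a i j * (poly_eval (y i) v)\<^sup>2 * poly_eval (y j) v)"
    for v
    by (simp add: a square_combination_def)
  have on: "a 1 1 = 0 \<and> a 1 i = 0 \<and> a i 1 = 0 \<and> a i i = 0"
    if "i = 2 \<or> i = 3" "vec.span (e ` {1, i}) \<subseteq> zeros f" for i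
  proof -
    have "a 1 1 * s ^ 3 + a 1 i * s\<^sup>2 * t + a i 1 * t\<^sup>2 * s + a i i * t ^ 3 = 0" for s t
    proof -
      have "s *s e 1 + t *s e i \<in> vec.span (e ` {1, i})"
        by (intro vec.span_add vec.span_scale vec.span_base) auto
      then have "poly_eval f (s *s e 1 + t *s e i) = 0"
        using that(2) by (auto simp: zeros_def)
      then show ?thesis
        using that(1)
        by (auto simp: eval sum_4 lin.add lin.scale dual power2_eq_square power3_eq_cube algebra_simps)
    qed
    then show ?thesis
      by (rule binary_cubic_eq_0[OF char])
  qed
  have "a 1 1 = 0" "a 1 2 = 0" "a 2 1 = 0" "a 2 2 = 0"
    using on[of 2] L'(2) spans(2) by auto
  moreover have "a 1 3 = 0" "a 3 1 = 0" "a 3 3 = 0"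
    using on[of 3] M'(2) spans(3) by auto
  ultimately have "y 4 dvd f - y 2 * y 3 * (const (a 2 3) * y 2 + const (a 3 2) * y 3)"
    unfolding a by (rule square_combination_mod_plane)
  with y spans show ?thesis
    using that by blast
qed

lemma poly_eval_mod:
  assumes "h dvd f - g" "poly_eval h v = 0"
  shows "poly_eval f v = poly_eval g v"
proof -
  from assms(1) obtain r where "f - g = h * r" ..
  then have "f = g + h * r"
    by (simp add: algebra_simps)
  then show ?thesis
    using assms(2) by simp
qed

section \<open>Lines on cubic surfaces that are not Frobenius split\<close>

text \<open>
  The residual line is given by \<open>b y\<^sub>2 + c y\<^sub>3 = 0\<close>.  It coincides with one of the two lines when exactly
  one of \<open>b\<close> and \<open>c\<close> vanishes, and is a third line through their common point when neither does.
  When both vanish, the plane lies on the surface, and any other line of the plane through that point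
  is a third one.
\<close>

lemma meeting_lines_double_or_eckardt:
  fixes f :: "'k::alg_closed_field poly4"
  assumes char: "CHAR('k) = 2" and f: "homogeneous 3 f" "\<not> surface_frobenius_split f"
    and L: "line_on f L" and M: "line_on f M" and LM: "proj_flat 0 (L \<inter> M)"
  shows "one_is_double f L M \<or> eckardt_point f (L \<inter> M)"
proof -
  obtain e y b c where y: "linear_coordinates e y"
    and spans: "L \<inter> M = vec.span (e ` {1})" "L = vec.span (e ` {1, 2})" "M = vec.span (e ` {1, 3})"
      "vec.span (L \<union> M) = vec.span (e ` {1, 2, 3})"
    and dvd: "y 4 dvd f - y 2 * y 3 * (const b * y 2 + const c * y 3)"
    using plane_section_of_meeting_lines[OF assms] .
  interpret linear_coordinates e y by fact
  interpret lin: Vector_Spaces.linear "(*s)" "(*)" "poly_eval (y j)" for j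
    by (rule linear)
  have compl: "- {1, 2} = {3, 4 :: 4}" "- {1, 3} = {2, 4 :: 4}" "- {1, 2, 3} = {4 :: 4}"
    using exhaust_4 by fastforce+
  have H: "vec.span (L \<union> M) = zeros (y 4)"
    and L': "L = zeros (y 4) \<inter> zeros (y 3)" and M': "M = zeros (y 4) \<inter> zeros (y 2)"
    unfolding spans(4) using spans(2,3) unfolding span_coordinate_vectors compl
    by (auto simp: zeros_def)
  have flatH: "proj_flat 2 (zeros (y 4))"
    unfolding H[symmetric] proj_flat_def spans(4) dim_span_coordinate_vectors by simp
  have flat: "proj_flat 1 L" "proj_flat 1 M"
    using L M by (auto simp: line_on_def)
  have hom: "homogeneous 1 (const d * y j)" for d j
    by (intro homogeneous_const_mult homogeneous_coordinate)
  consider "b = 0" "c \<noteq> 0" | "b \<noteq> 0" "c = 0" | "b = 0 \<longleftrightarrow> c = 0"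
    by blast
  then show ?thesis
  proof cases
    case 1
    have "y 4 dvd f - y 3 * y 2 * (const c * y 3)"
      using dvd 1 by (simp add: ac_simps)
    moreover have "L = zeros (y 4) \<inter> zeros (const c * y 3)"
      unfolding L' using 1 by (auto simp: zeros_def)
    ultimately have "plane_section f (zeros (y 4)) L M L"
      unfolding plane_section_def using flatH flat L' M' homogeneous_coordinate hom by blast
    then show ?thesis
      unfolding one_is_double_def H by blast
  next
    case 2
    have "y 4 dvd f - y 3 * y 2 * (const b * y 2)"
      using dvd 2 by (simp add: ac_simps)
    moreover have "M = zeros (y 4) \<inter> zeros (const b * y 2)"
      unfolding M' using 2 by (auto simp: zeros_def)
    ultimately have "plane_section f (zeros (y 4)) L M M"
      unfolding plane_section_def using flatH flat L' M' homogeneous_coordinate hom by blast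
    then show ?thesis
      unfolding one_is_double_def H by blast
  next
    case 3
    \<comment> \<open>A direction in which the residual form vanishes and which is on neither line.\<close>
    obtain p q where pq: "p \<noteq> 0" "q \<noteq> 0" "b * p + c * q = 0"
    proof (cases "b = 0")
      case True
      then show ?thesis using that[of 1 1] 3 by simp
    next
      case False
      then show ?thesis using that[of c "- b"] 3 by simp
    qed
    define u where "u = p *s e 2 + q *s e 3"
    define N where "N = vec.span {e 1, u}"
    have yu: "poly_eval (y j) u = (if j = 2 then p else if j = 3 then q else 0)" for j
      by (simp add: u_def lin.add lin.scale dual)
    have u: "u \<notin> L" "u \<notin> M"
      unfolding L' M' using yu[of 2] yu[of 3] pq by (auto simp: zeros_def)
    have e1: "L \<inter> M = vec.span {e 1}"
      using spans(1) by simp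
    have "e 1 \<in> L \<inter> M"
      unfolding e1 by (simp add: vec.span_base)
    then have "u \<noteq> e 1"
      using u by auto
    have "e 1 \<noteq> 0"
    proof
      assume "e 1 = 0"
      then show False
        using dual[of 1 1] lin.zero[of 1] by simp
    qed
    then have "vec.independent {e 1}"
      by simp
    moreover have "u \<notin> vec.span {e 1}"
      using u unfolding e1[symmetric] by blast
    ultimately have "vec.independent {u, e 1}"
      by (rule vec.independent_insertI[rotated])
    then have "vec.dim {u, e 1} = 2"
      using \<open>u \<noteq> e 1\<close> by (simp add: vec.dim_eq_card_independent)
    then have "vec.dim N = 2"
      unfolding N_def vec.dim_span by (simp add: insert_commute)
    then have "proj_flat 1 N"
      by (simp add: proj_flat_def N_def)
    moreover have "N \<subseteq> zeros f"
    proof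
      fix v
      assume "v \<in> N"
      then obtain r s where v: "v = r *s e 1 + s *s u"
        unfolding N_def vec.span_insert vec.span_singleton
        by (auto simp: algebra_simps)
      have v4: "poly_eval (y 4) v = 0" and v2: "poly_eval (y 2) v = s * p" and v3: "poly_eval (y 3) v = s * q"
        by (simp_all add: v lin.add lin.scale dual yu)
      have "poly_eval f v = s * p * (s * q) * (s * (b * p + c * q))"
        using poly_eval_mod[OF dvd v4] by (simp add: v2 v3 algebra_simps)
      then show "v \<in> zeros f"
        by (simp add: zeros_def pq(3))
    qed
    moreover have "u \<in> N" "L \<inter> M \<subseteq> N"
      unfolding e1 N_def by (auto intro: vec.span_base vec.span_mono[THEN subsetD, rotated])
    moreover have "L \<noteq> M"
      using LM flat by (auto simp: proj_flat_def)
    ultimately have "eckardt_point f (L \<inter> M)"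
      unfolding eckardt_point_def line_on_def using LM L M u
      by (intro conjI exI[of _ L] exI[of _ M] exI[of _ N]) (auto simp: line_on_def)
    then show ?thesis ..
  qed
qed

lemma coplanar_lines_meet:
  fixes L M H :: "('k::field ^ 4) set"
  assumes H: "proj_flat 2 H" and L: "proj_flat 1 L" "L \<subseteq> H" and M: "proj_flat 1 M" "M \<subseteq> H"
    and "L \<noteq> M"
  shows "proj_flat 0 (L \<inter> M)"
proof -
  have sub: "vec.subspace H" "vec.subspace L" "vec.subspace M" "vec.subspace (L \<inter> M)"
    and dim: "vec.dim H = 3" "vec.dim L = 2" "vec.dim M = 2"
    using assms by (auto simp: proj_flat_def vec.subspace_inter)
  have "{x + y |x y. x \<in> L \<and> y \<in> M} \<subseteq> H"
    using L(2) M(2) sub(1) by (auto intro: vec.subspace_add)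
  then have "vec.dim {x + y |x y. x \<in> L \<and> y \<in> M} \<le> 3"
    unfolding dim(1)[symmetric] by (rule vec.dim_subset)
  then have "vec.dim (L \<inter> M) \<ge> 1"
    using vec.dim_sums_Int[OF sub(2,3)] dim by linarith
  moreover have "vec.dim (L \<inter> M) < 2"
  proof (rule ccontr)
    assume "\<not> ?thesis"
    then have "L \<inter> M = L" "L \<inter> M = M"
      using sub dim by (simp_all only: vec.subspace_dim_equal Int_lower1 Int_lower2 not_less)
    with \<open>L \<noteq> M\<close> show False by blast
  qed
  ultimately show ?thesis
    using sub(4) by (simp add: proj_flat_def)
qed

text \<open>
  On the plane spanned by two of the lines, \<open>f\<close> does not change along the direction of their common
  point, as its restriction is free of \<open>y\<^sub>1\<close>.  The third line does not contain that point, so that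
  every vector of the plane differs by a multiple of this direction from a vector of the third line,
  where \<open>f\<close> vanishes.
\<close>

lemma plane_of_triangle_subset_surface:
  fixes f :: "'k::alg_closed_field poly4"
  assumes char: "CHAR('k) = 2" and f: "homogeneous 3 f" "\<not> surface_frobenius_split f"
    and T: "triangle_in_plane f H T"
  shows "H \<subseteq> zeros f"
proof -
  have H: "proj_flat 2 H" and "card T = 3" and lines: "\<And>L. L \<in> T \<Longrightarrow> line_on f L \<and> L \<subseteq> H"
    and Int: "\<Inter>T = {0}"
    using T by (auto simp: triangle_in_plane_def)
  then obtain L M N where "T = {L, M, N}" "L \<noteq> M"
    by (auto simp: card_3_iff)
  then have L: "line_on f L" "L \<subseteq> H" and M: "line_on f M" "M \<subseteq> H" and N: "line_on f N" "N \<subseteq> H"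
    and LMN: "N \<inter> (L \<inter> M) = {0}"
    using lines Int by auto
  have LM: "proj_flat 0 (L \<inter> M)"
    using coplanar_lines_meet[OF H _ L(2) _ M(2) \<open>L \<noteq> M\<close>] L(1) M(1) by (simp add: line_on_def)
  obtain e y b c where y: "linear_coordinates e y"
    and spans: "L \<inter> M = vec.span (e ` {1})" "L = vec.span (e ` {1, 2})" "M = vec.span (e ` {1, 3})"
      "vec.span (L \<union> M) = vec.span (e ` {1, 2, 3})"
    and dvd: "y 4 dvd f - y 2 * y 3 * (const b * y 2 + const c * y 3)"
    using plane_section_of_meeting_lines[OF char f L(1) M(1) LM] .
  interpret linear_coordinates e y by fact
  interpret lin: Vector_Spaces.linear "(*s)" "(*)" "poly_eval (y j)" for j
    by (rule linear)
  have compl: "- {1, 2, 3} = {4 :: 4}" "- {1} = {2, 3, 4 :: 4}"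
    using exhaust_4 by fastforce+
  have sub: "vec.subspace H" "vec.subspace N" "vec.subspace (L \<inter> M)"
    and dim: "vec.dim H = 3" "vec.dim N = 2" "vec.dim (L \<inter> M) = 1"
    using H N(1) LM by (auto simp: proj_flat_def line_on_def)
  have "vec.span (L \<union> M) = H"
  proof (rule vec.subspace_dim_equal)
    show "vec.span (L \<union> M) \<subseteq> H"
      using L(2) M(2) sub(1) by (intro vec.span_minimal) auto
    show "vec.dim H \<le> vec.dim (vec.span (L \<union> M))"
      unfolding spans(4) dim_span_coordinate_vectors dim(1) by simp
  qed (use sub in auto)
  then have H': "H = zeros (y 4)"
    unfolding spans(4) span_coordinate_vectors compl by (auto simp: zeros_def)
  \<comment> \<open>The third line and the common point of the other two span the plane.\<close>
  have "{x + z |x z. x \<in> N \<and> z \<in> L \<inter> M} = H"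
  proof (rule vec.subspace_dim_equal)
    show "vec.subspace {x + z |x z. x \<in> N \<and> z \<in> L \<inter> M}"
      by (rule vec.subspace_sums[OF sub(2,3)])
    show "{x + z |x z. x \<in> N \<and> z \<in> L \<inter> M} \<subseteq> H"
      using N(2) L(2) sub(1) by (auto intro: vec.subspace_add)
    have "vec.dim {0 :: 'k ^ 4} = 0"
      by (simp add: vec.dim_insert vec.span_empty)
    then show "vec.dim H \<le> vec.dim {x + z |x z. x \<in> N \<and> z \<in> L \<inter> M}"
      using vec.dim_sums_Int[OF sub(2,3)] LMN dim by simp
  qed (rule sub(1))
  show "H \<subseteq> zeros f"
  proof
    fix v
    assume "v \<in> H"
    then obtain x z where v: "v = x + z" and x: "x \<in> N" and z: "z \<in> L \<inter> M"
      using \<open>{x + z |x z. x \<in> N \<and> z \<in> L \<inter> M} = H\<close> by blast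
    have "poly_eval (y j) z = 0" if "j \<noteq> 1" for j
      using z that unfolding spans(1) span_coordinate_vectors by auto
    then have vx: "poly_eval (y j) v = poly_eval (y j) x" if "j \<noteq> 1" for j
      using that by (simp add: v lin.add)
    have v4: "poly_eval (y 4) v = 0" "poly_eval (y 4) x = 0"
      using \<open>v \<in> H\<close> x N(2) by (auto simp: H' zeros_def)
    have "poly_eval f v = poly_eval f x"
      using poly_eval_mod[OF dvd v4(1)] poly_eval_mod[OF dvd v4(2)] vx[of 2] vx[of 3] by simp
    also have "\<dots> = 0"
      using x N(1) by (auto simp: line_on_def zeros_def)
    finally show "v \<in> zeros f"
      by (simp add: zeros_def)
  qed
qed

theorem theorem5p1:
  fixes f :: "'k::alg_closed_field poly4"
  assumes "CHAR('k) = 2"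
    and "f \<noteq> 0" and "homogeneous 3 f"
    and "\<not> surface_frobenius_split f"
  shows "(\<forall>L M. line_on f L \<and> line_on f M \<and> proj_flat 0 (L \<inter> M) \<longrightarrow>
            one_is_double f L M \<or> eckardt_point f (L \<inter> M)) \<and>
         \<not> (\<exists>H T. \<not> H \<subseteq> zeros f \<and> triangle_in_plane f H T)"
  using meeting_lines_double_or_eckardt[OF assms(1,3,4)]
    plane_of_triangle_subset_surface[OF assms(1,3,4)] by blast

end
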